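(* Assume that the optimal solution set $\Omega_\lambda$ of the problem $\min_{w\in\mathbb{R}^n,v\in\mathbb{R}}f(w,v)$ is nonempty and compact, and that the parameter sequences $\{\sigma_k\},\{\gamma_k\}$ of the dual Newton method based proximal point algorithm (PPDNA, described in the context) satisfy Assumption 1 stated in the context. (1) Let $\{(w^k,v^k)\}$ be the sequence generated by the PPDNA with stopping criterion (A). Then $\{(w^k,v^k)\}$ is bounded and $$\mathrm{dist}_{\mathcal{M}_{k+1}}((w^{k+1},v^{k+1}),\Omega_\lambda)\le \mathrm{dist}_{\mathcal{M}_k}((w^k,v^k),\Omega_\lambda)+\epsilon_k,\qquad\forall k\ge 0.$$ In addition, $\{(w^k,v^k)\}$ converges to an optimal point $(w^*,v^* )$ of the problem $\min f$, such that $0\in\mathcal{T}_f(w^*,v^* )$. (2) Let $r:=\sum_{k=0}^\infty\epsilon_k+\mathrm{dist}_{\mathcal{M}_0}((w^0,v^0),\Omega_\lambda)$. Then, for this $r>0$, there exists a constant $\kappa>0$ such that $\mathcal{T}_f$ satisfies the error bound condition $$\mathrm{dist}((w,v),\Omega_\lambda)\le\kappa\,\mathrm{dist}(0,\mathcal{T}_f(w,v))\quad\text{for all }(w,v)\in\mathbb{R}^n\times\mathbb{R}\text{ with }\mathrm{dist}((w,v),\Omega_\lambda)\le r.$$ Suppose that $\{(w^k,v^k)\}$ is the sequence generated by the PPDNA with the stopping criteria (A) and (B), with nondecreasing $\{\sigma_k\}$. Then for all $k\ge0$, $$\mathrm{dist}_{\mathcal{M}_{k+1}}((w^{k+1},v^{k+1}),\Omega_\lambda)\le\mu_k\,\mathrm{dist}_{\mathcal{M}_k}((w^k,v^k),\Omega_\lambda),$$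 where $$\mu_k=\frac{1}{1-\delta_k}\left[\delta_k+\frac{(1+\delta_k)\kappa\lambda_{\max}(\mathcal{M}_k)}{\sqrt{\sigma_k^2+\kappa^2\lambda_{\max}^2(\mathcal{M}_k)}}\right]$$ and $$\limsup_{k\to\infty}\mu_k=\mu_\infty=\frac{\kappa\lambda_\infty}{\sqrt{\sigma_\infty^2+\kappa^2\lambda_\infty^2}}<1\qquad\text{with }\lambda_\infty=\limsup_{k\to\infty}\lambda_{\max}(\mathcal{M}_k)$$ (where $\mu_\infty=0$ if $\sigma_\infty=\infty$). In addition, for all $k\ge0$, $$\mathrm{dist}((w^{k+1},v^{k+1}),\Omega_\lambda)\le\frac{\mu_k}{\sqrt{\lambda_{\min}(\mathcal{M}_{k+1})}}\,\mathrm{dist}_{\mathcal{M}_k}((w^k,v^k),\Omega_\lambda).$$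
   Context: Problem. Data: $(a_i,b_i)\in\mathbb{R}^n\times\{-1,1\}$, $i=1,\dots,m$; $A=[a_1,\dots,a_m]^\top\in\mathbb{R}^{m\times n}$; $b=(b_1,\dots,b_m)^\top$; $\lambda>0$; $\mathbf{1}_m$ is the all-ones vector. Loss $h(x)=\frac1m\sum_{i=1}^m\log(1+\exp(-b_ix_i))$, regularizer $p(w)=\|w\|_1$, objective $f(w,v)=h(Aw+v\mathbf{1}_m)+\lambda p(w)$ on $\mathbb{R}^n\times\mathbb{R}$. $\Omega_\lambda$ is the set of minimizers of $f$, and $\mathcal{T}_f=\partial f$ is the convex subdifferential of $f$, i.e. $$\mathcal{T}_f(w,v)=\begin{bmatrix}A^\top\nabla h(Aw+v\mathbf{1}_m)+\partial(\lambda p)(w)\\ \mathbf{1}_m^\top\nabla h(Aw+v\mathbf{1}_m)\end{bmatrix}.$$ Notation. $h^*$ is the convex conjugate of $h$, with $\mathrm{dom}\,h^*=\{u\in\mathbb{R}^m: -\frac1m<u_ib_i<0\ \forall i\}$. For a closed proper convex function $g$ on $\mathbb{R}^n$, $E_g(x)=\min_y\{g(y)+\frac12\|y-x\|^2\}$ and $\mathrm{Prox}_g(x)$ is the unique minimizer. For a positive semidefinite matrix $\mathcal{M}$, $\|x\|_{\mathcal{M}}=\sqrt{\langle x,\mathcal{M}x\rangle}$ and $\mathrm{dist}_{\mathcal{M}}(x,\mathcal{C})=\inf_{x'\in\mathcal{C}}\|x-x'\|_{\mathcal{M}}$; $\mathrm{dist}$ without subscript is the Euclidean distance. $\lambda_{\max}(\mathcal{M}),\lambda_{\min}(\mathcal{M})$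 are the largest and smallest eigenvalues. $(w;v)$ is the vector in $\mathbb{R}^{n+1}$ obtained by stacking. PPDNA. Choose $\sigma_0,\gamma_0>0$, $(w^0,v^0)\in\mathbb{R}^n\times\mathbb{R}$. For $k=0,1,2,\dots$: compute an approximate minimizer $u^{k+1}\in\mathrm{dom}\,h^*$ of $$\psi_k(u)=h^*(u)-\tfrac1{\sigma_k}E_{\sigma_k\lambda p}(w^k-\sigma_kA^\top u)+\tfrac1{2\sigma_k}\|w^k-\sigma_kA^\top u\|^2-\tfrac1{2\sigma_k}\|w^k\|^2+\tfrac1{2\gamma_k}(v^k-\gamma_ku^\top\mathbf{1}_m)^2-\tfrac1{2\gamma_k}(v^k)^2$$ over $u\in\mathrm{dom}\,h^*$, accurate enough that the stopping criteria in force hold for $$w^{k+1}=\mathrm{Prox}_{\sigma_k\lambda\|\cdot\|_1}(w^k-\sigma_kA^\top u^{k+1}),\qquad v^{k+1}=v^k-\gamma_k(u^{k+1})^\top\mathbf{1}_m;$$ then update $\sigma_{k+1}\uparrow\sigma_\infty\le\infty$, $\gamma_{k+1}\uparrow\gamma_\infty\le\infty$. Let $\mathcal{M}_k=\mathrm{Diag}(\mathbf{1}_n;\sigma_k\gamma_k^{-1})\in\mathbb{R}^{(n+1)\times(n+1)}$ and let $$\mathcal{P}_k(w^k,v^k)=\arg\min_{w,v}\Big\{h(Aw+v\mathbf{1}_m)+\lambda p(w)+\tfrac1{2\sigma_k}\|(w;v)-(w^k;v^k)\|_{\mathcal{M}_k}^2\Big\}.$$ Stopping criteria: (A) $\|(w^{k+1};v^{k+1})-\mathcal{P}_k(w^k,v^k)\|_{\mathcal{M}_k}\le\epsilon_k$,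 where $\epsilon_k\ge0$ and $\sum_{k=0}^\infty\epsilon_k<\infty$; (B) $\|(w^{k+1};v^{k+1})-\mathcal{P}_k(w^k,v^k)\|_{\mathcal{M}_k}\le\delta_k\|(w^{k+1};v^{k+1})-(w^k;v^k)\|_{\mathcal{M}_k}$, where $0\le\delta_k<1$ and $\sum_{k=0}^\infty\delta_k<\infty$. Assumption 1. The sequences $\{\sigma_k\gamma_k^{-1}\}$ and $\{\sigma_k\}$ of positive reals are both bounded away from $0$, and the positive definite matrices $\mathcal{M}_k$ satisfy $\mathcal{M}_k\succeq\mathcal{M}_{k+1}$ and $\mathcal{M}_k\succeq\min\{1,\sigma_\infty\gamma_\infty^{-1}\}I_{n+1}$ for all $k\ge0$, where $\sigma_\infty\gamma_\infty^{-1}$ is read as $\lim_k\sigma_k\gamma_k^{-1}$ when $\sigma_\infty$ or $\gamma_\infty$ is infinite. *)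

theory Defs
  imports "HOL-Analysis.Analysis"
begin

definition subdifferential :: "('a::real_inner \<Rightarrow> real) \<Rightarrow> 'a \<Rightarrow> 'a set" where
  "subdifferential f x = {g. \<forall>y. f x + g \<bullet> (y - x) \<le> f y}"

definition minimizers :: "('a \<Rightarrow> real) \<Rightarrow> 'a set" where
  "minimizers f = {x. is_arg_min f (\<lambda>_. True) x}"

definition conjugate :: "('a::real_inner \<Rightarrow> real) \<Rightarrow> 'a \<Rightarrow> ereal" where
  "conjugate f u = (SUP x. ereal (x \<bullet> u - f x))"

definition moreau_env :: "('a::real_inner \<Rightarrow> real) \<Rightarrow> 'a \<Rightarrow> real" where
  "moreau_env g x = (INF y. g y + 1/2 * (norm (y - x))\<^sup>2)"

definition prox :: "('a::real_inner \<Rightarrow> real) \<Rightarrow> 'a \<Rightarrow> 'a" where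
  "prox g x = (THE y. y \<in> minimizers (\<lambda>y. g y + 1/2 * (norm (y - x))\<^sup>2))"

definition eigenvalues :: "real^'k^'k \<Rightarrow> real set" where
  "eigenvalues M = {l. \<exists>x. x \<noteq> 0 \<and> M *v x = l *\<^sub>R x}"

definition lambda_max :: "real^'k^'k \<Rightarrow> real" where
  "lambda_max M = Max (eigenvalues M)"

definition lambda_min :: "real^'k^'k \<Rightarrow> real" where
  "lambda_min M = Min (eigenvalues M)"

definition psd :: "real^'k^'k \<Rightarrow> bool" where
  "psd M \<longleftrightarrow> transpose M = M \<and> (\<forall>x. 0 \<le> x \<bullet> (M *v x))"

definition loewner_le :: "real^'k^'k \<Rightarrow> real^'k^'k \<Rightarrow> bool"  (infix "\<preceq>" 50) where
  "M \<preceq> N \<longleftrightarrow> psd (N - M)"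

definition mnorm :: "real^'k^'k \<Rightarrow> real^'k \<Rightarrow> real" where
  "mnorm M x = sqrt (x \<bullet> (M *v x))"

definition dist_M :: "real^'k^'k \<Rightarrow> real^'k \<Rightarrow> (real^'k) set \<Rightarrow> real" where
  "dist_M M x C = (INF y\<in>C. mnorm M (x - y))"

text \<open>The rows of \<open>A :: real^'n^'m\<close> are the feature vectors and \<open>b\<close> holds the labels. The constant
  \<open>1 :: real^'m\<close> is the all-ones vector. Pairs \<open>(w, v)\<close> carry the product inner product, so their
  norm is the Euclidean norm of the stacked vector.\<close>

definition logistic_loss :: "real^'m \<Rightarrow> real^'m \<Rightarrow> real" where
  "logistic_loss b x = 1 / real CARD('m) * (\<Sum>i\<in>UNIV. ln (1 + exp (- b $ i * x $ i)))"

definition l1_norm :: "real^'n \<Rightarrow> real" where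
  "l1_norm w = (\<Sum>i\<in>UNIV. \<bar>w $ i\<bar>)"

definition objective :: "real^'n^'m \<Rightarrow> real^'m \<Rightarrow> real \<Rightarrow> (real^'n) \<times> real \<Rightarrow> real" where
  "objective A b lam = (\<lambda>(w, v). logistic_loss b (A *v w + v *\<^sub>R 1) + lam * l1_norm w)"

definition Omega :: "real^'n^'m \<Rightarrow> real^'m \<Rightarrow> real \<Rightarrow> ((real^'n) \<times> real) set" where
  "Omega A b lam = minimizers (objective A b lam)"

definition T_f :: "real^'n^'m \<Rightarrow> real^'m \<Rightarrow> real \<Rightarrow> (real^'n) \<times> real \<Rightarrow> ((real^'n) \<times> real) set" where
  "T_f A b lam = subdifferential (objective A b lam)"

text \<open>The vector \<open>(w; v)\<close>, with index type \<open>'n + 1\<close> of cardinality \<open>CARD('n) + 1\<close>.\<close>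

definition stack :: "(real^'n) \<times> real \<Rightarrow> real^('n + 1)" where
  "stack z = (\<chi> i. case i of Inl j \<Rightarrow> fst z $ j | Inr _ \<Rightarrow> snd z)"

definition precond :: "real \<Rightarrow> real \<Rightarrow> real^('n::finite + 1)^('n + 1)" where
  "precond s g = (\<chi> i j. if i = j then (case i of Inl _ \<Rightarrow> 1 | Inr _ \<Rightarrow> s / g) else 0)"

definition prox_point ::
  "real^'n^'m \<Rightarrow> real^'m \<Rightarrow> real \<Rightarrow> real \<Rightarrow> real \<Rightarrow> (real^'n) \<times> real \<Rightarrow> (real^'n) \<times> real" where
  "prox_point A b lam s g z = (THE z'. z' \<in> minimizers
     (\<lambda>y. objective A b lam y + 1 / (2 * s) * (mnorm (precond s g) (stack y - stack z))\<^sup>2))"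

text \<open>The dual iterates range over the open box (the closed box is where \<open>conjugate (logistic_loss b)\<close>
  is finite; the finite boundary values are excluded by convention).\<close>

definition dom_conj :: "real^'m \<Rightarrow> (real^'m) set" where
  "dom_conj b = {u. \<forall>i. - 1 / real CARD('m) < u $ i * b $ i \<and> u $ i * b $ i < 0}"

definition psi :: "real^'n^'m \<Rightarrow> real^'m \<Rightarrow> real \<Rightarrow> real \<Rightarrow> real \<Rightarrow> real^'n \<Rightarrow> real \<Rightarrow> real^'m \<Rightarrow> ereal" where
  "psi A b lam s g w v u = conjugate (logistic_loss b) u + ereal (
     - 1 / s * moreau_env (\<lambda>y. s * lam * l1_norm y) (w - s *\<^sub>R (transpose A *v u))
     + 1 / (2 * s) * (norm (w - s *\<^sub>R (transpose A *v u)))\<^sup>2 - 1 / (2 * s) * (norm w)\<^sup>2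
     + 1 / (2 * g) * (v - g * (u \<bullet> 1))\<^sup>2 - 1 / (2 * g) * v\<^sup>2)"

text \<open>The accuracy of \<open>u (Suc k)\<close> is prescribed by the stopping criteria alone, so the tolerance \<open>\<eta>\<close> is
  existentially quantified.\<close>

definition approx_minimizer :: "('a \<Rightarrow> ereal) \<Rightarrow> 'a set \<Rightarrow> 'a \<Rightarrow> bool" where
  "approx_minimizer \<psi> S u \<longleftrightarrow> u \<in> S \<and> (\<exists>\<eta>\<ge>0. \<forall>u'\<in>S. \<psi> u \<le> \<psi> u' + ereal \<eta>)"

text \<open>Only convergence of the parameters in the extended reals is required. Monotonicity of \<open>\<sigma>\<close> is
  a separate hypothesis where it is needed.\<close>

definition ppdna_params :: "(nat \<Rightarrow> real) \<Rightarrow> (nat \<Rightarrow> real) \<Rightarrow> ereal \<Rightarrow> ereal \<Rightarrow> bool" where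
  "ppdna_params \<sigma> \<gamma> \<sigma>inf \<gamma>inf \<longleftrightarrow> (\<forall>k. 0 < \<sigma> k \<and> 0 < \<gamma> k) \<and>
     (\<lambda>k. ereal (\<sigma> k)) \<longlonglongrightarrow> \<sigma>inf \<and> (\<lambda>k. ereal (\<gamma> k)) \<longlonglongrightarrow> \<gamma>inf"

definition ppdna :: "real^'n^'m \<Rightarrow> real^'m \<Rightarrow> real \<Rightarrow> (nat \<Rightarrow> real) \<Rightarrow> (nat \<Rightarrow> real) \<Rightarrow>
    real^'n \<Rightarrow> real \<Rightarrow> (nat \<Rightarrow> real^'m) \<Rightarrow> (nat \<Rightarrow> real^'n) \<Rightarrow> (nat \<Rightarrow> real) \<Rightarrow> bool" where
  "ppdna A b lam \<sigma> \<gamma> w0 v0 u w v \<longleftrightarrow> w 0 = w0 \<and> v 0 = v0 \<and>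
     (\<forall>k. approx_minimizer (psi A b lam (\<sigma> k) (\<gamma> k) (w k) (v k)) (dom_conj b) (u (Suc k)) \<and>
          w (Suc k) = prox (\<lambda>y. \<sigma> k * lam * l1_norm y) (w k - \<sigma> k *\<^sub>R (transpose A *v u (Suc k))) \<and>
          v (Suc k) = v k - \<gamma> k * (u (Suc k) \<bullet> 1))"

definition criterion_A :: "real^'n^'m \<Rightarrow> real^'m \<Rightarrow> real \<Rightarrow> (nat \<Rightarrow> real) \<Rightarrow> (nat \<Rightarrow> real) \<Rightarrow>
    (nat \<Rightarrow> real) \<Rightarrow> (nat \<Rightarrow> real^'n) \<Rightarrow> (nat \<Rightarrow> real) \<Rightarrow> bool" where
  "criterion_A A b lam \<sigma> \<gamma> \<epsilon> w v \<longleftrightarrow> (\<forall>k. 0 \<le> \<epsilon> k) \<and> summable \<epsilon> \<and>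
     (\<forall>k. mnorm (precond (\<sigma> k) (\<gamma> k))
            (stack (w (Suc k), v (Suc k)) - stack (prox_point A b lam (\<sigma> k) (\<gamma> k) (w k, v k))) \<le> \<epsilon> k)"

definition criterion_B :: "real^'n^'m \<Rightarrow> real^'m \<Rightarrow> real \<Rightarrow> (nat \<Rightarrow> real) \<Rightarrow> (nat \<Rightarrow> real) \<Rightarrow>
    (nat \<Rightarrow> real) \<Rightarrow> (nat \<Rightarrow> real^'n) \<Rightarrow> (nat \<Rightarrow> real) \<Rightarrow> bool" where
  "criterion_B A b lam \<sigma> \<gamma> \<delta> w v \<longleftrightarrow> (\<forall>k. 0 \<le> \<delta> k \<and> \<delta> k < 1) \<and> summable \<delta> \<and>
     (\<forall>k. mnorm (precond (\<sigma> k) (\<gamma> k))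
            (stack (w (Suc k), v (Suc k)) - stack (prox_point A b lam (\<sigma> k) (\<gamma> k) (w k, v k)))
          \<le> \<delta> k * mnorm (precond (\<sigma> k) (\<gamma> k)) (stack (w (Suc k), v (Suc k)) - stack (w k, v k)))"

definition ratio_inf :: "(nat \<Rightarrow> real) \<Rightarrow> (nat \<Rightarrow> real) \<Rightarrow> ereal \<Rightarrow> ereal \<Rightarrow> real" where
  "ratio_inf \<sigma> \<gamma> \<sigma>inf \<gamma>inf = (if \<sigma>inf = \<infinity> \<or> \<gamma>inf = \<infinity> then lim (\<lambda>k. \<sigma> k / \<gamma> k)
     else real_of_ereal \<sigma>inf / real_of_ereal \<gamma>inf)"

text \<open>The type argument fixes the dimension of the matrices \<open>precond (\<sigma> k) (\<gamma> k)\<close>.\<close>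

definition param_assumption ::
  "'n::finite itself \<Rightarrow> (nat \<Rightarrow> real) \<Rightarrow> (nat \<Rightarrow> real) \<Rightarrow> ereal \<Rightarrow> ereal \<Rightarrow> bool" where
  "param_assumption (_ :: 'n itself) \<sigma> \<gamma> \<sigma>inf \<gamma>inf \<longleftrightarrow>
     (\<exists>c>0. \<forall>k. c \<le> \<sigma> k / \<gamma> k) \<and> (\<exists>c>0. \<forall>k. c \<le> \<sigma> k) \<and>
     (\<forall>k. (precond (\<sigma> (Suc k)) (\<gamma> (Suc k)) :: real^('n + 1)^('n + 1)) \<preceq> precond (\<sigma> k) (\<gamma> k)) \<and>
     (\<forall>k. (mat (min 1 (ratio_inf \<sigma> \<gamma> \<sigma>inf \<gamma>inf)) :: real^('n + 1)^('n + 1)) \<preceq> precond (\<sigma> k) (\<gamma> k))"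

definition rate :: "real^'k^'k \<Rightarrow> real \<Rightarrow> real \<Rightarrow> real \<Rightarrow> real" where
  "rate M s d \<kappa> = 1 / (1 - d) *
     (d + (1 + d) * \<kappa> * lambda_max M / sqrt (s\<^sup>2 + \<kappa>\<^sup>2 * (lambda_max M)\<^sup>2))"

definition rate_inf :: "real \<Rightarrow> ereal \<Rightarrow> real \<Rightarrow> real" where
  "rate_inf l \<sigma>inf \<kappa> = (if \<sigma>inf = \<infinity> then 0
     else \<kappa> * l / sqrt ((real_of_ereal \<sigma>inf)\<^sup>2 + \<kappa>\<^sup>2 * l\<^sup>2))"

end

theory Submission
  imports Defs
begin

text \<open>The exact proximal step in the metric \<open>M\<close> is Fejer monotone towards the solution set and its
  residual \<open>M (z - x) / s\<close> is a subgradient at the new point \<open>x\<close>. Summable errors preserve this up to a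
  convergent correction, so the iterates are bounded, the residuals vanish, every cluster point is
  optimal and the whole sequence converges. An error bound for the subdifferential turns the
  residual estimate into the linear rate.

  The error bound follows from quadratic growth on bounded sets. At a solution \<open>z0\<close> with prediction \<open>y0\<close>
  the objective gap is the Bregman distance of the logistic loss, which dominates the squared distance
  of the predictions to \<open>y0\<close> on bounded sets, plus a nonnegative piecewise linear function. Both vanish
  exactly on a polyhedron contained in the solution set, and Hoffman's inequality bounds the distance to
  that polyhedron.\<close>

section \<open>Hoffman's inequality\<close>

text \<open>The curvature of the logistic loss degenerates at infinity, so the growth estimate can
  only be expected on bounded sets. Compactness of the solution set supplies them: every tube around
  it is compact, and there both a curvature constant and a bound on the objective gap exist. Growth
  then gives the error bound because convexity bounds the gap by the norm of a subgradient times the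
  distance to the nearest solution, and one factor of the distance cancels.

  Each metric is the identity up to a single weight \<open>\<sigma> k / \<gamma> k\<close>, so it is
  realised by rescaling one coordinate, and distances in it are ordinary distances between rescaled
  sets. The weights decrease, hence passing to the next metric never increases a distance; their
  first value and their positive lower bound compare all metrics with the Euclidean one uniformly in
  \<open>k\<close>. The constant \<open>\<kappa>\<close> has to be fixed before the iterates are
  known. This is possible because the radius that it must serve depends only on the problem data,
  the starting point, the sum of the tolerances and the lower bound of the weights.\<close>

text \<open>If \<open>p\<close> is the projection of \<open>z\<close> and \<open>J\<close> the set of constraints active at \<open>p\<close>, then \<open>z - p\<close> lies in
  the polar \<open>K J\<close> of the tangent cone. No unit vector of \<open>K J\<close> satisfies all homogeneous constraints of
  \<open>J\<close>, so compactness gives a positive constant for each of the finitely many \<open>J\<close>.\<close>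

lemma hoffman_bound:
  fixes a :: "'i \<Rightarrow> 'a::euclidean_space" and \<beta> :: "'i \<Rightarrow> real"
  assumes "finite I" and P: "P = {x. \<forall>i\<in>I. a i \<bullet> x \<le> \<beta> i}" and ne: "P \<noteq> {}"
  obtains C where "C > 0" "\<And>z. infdist z P \<le> C * (\<Sum>i\<in>I. max 0 (a i \<bullet> z - \<beta> i))"
proof -
  define K where "K J = {d. \<forall>e. (\<forall>i\<in>J. a i \<bullet> e \<le> 0) \<longrightarrow> e \<bullet> d \<le> 0}" for J
  define G where "G J d = (\<Sum>i\<in>J. max 0 (a i \<bullet> d))" for J d
  have "\<exists>c>0. \<forall>d\<in>K J. c * norm d \<le> G J d" if "J \<subseteq> I" for J
  proof -
    have fin: "finite J" using that \<open>finite I\<close> finite_subset by blast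
    have "K J = (\<Inter>e\<in>{e. \<forall>i\<in>J. a i \<bullet> e \<le> 0}. {d. e \<bullet> d \<le> 0})"
      by (auto simp: K_def)
    then have "closed (K J)" by (auto intro!: closed_INT closed_halfspace_le)
    then have cpt: "compact (K J \<inter> sphere 0 1)" by (simp add: closed_Int_compact)
    have cont: "continuous_on (K J \<inter> sphere 0 1) (G J)"
      unfolding G_def by (intro continuous_intros)
    have pos: "0 < G J d" if d: "d \<in> K J \<inter> sphere 0 1" for d
    proof (rule ccontr)
      assume "\<not> 0 < G J d"
      moreover have "0 \<le> G J d" unfolding G_def by (intro sum_nonneg) auto
      ultimately have "G J d = 0" by simp
      then have "\<forall>i\<in>J. max 0 (a i \<bullet> d) = 0"
        unfolding G_def using fin by (subst (asm) sum_nonneg_eq_0_iff) auto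
      then have "\<forall>i\<in>J. a i \<bullet> d \<le> 0" by (auto simp: max_def split: if_splits)
      \<comment> \<open>A vector of the polar that itself satisfies the homogeneous constraints may
        be tested against itself.\<close>
      then have "d \<bullet> d \<le> 0" using d by (auto simp: K_def)
      then show False using d by (auto simp: dot_square_norm)
    qed
    obtain c where c: "c > 0" "\<forall>d\<in>K J \<inter> sphere 0 1. c \<le> G J d"
    proof (cases "K J \<inter> sphere 0 1 = {}")
      case True
      then show ?thesis using that[of 1] by simp
    next
      case False
      then show ?thesis using continuous_attains_inf[OF cpt False cont] pos that by blast
    qed
    have "c * norm d \<le> G J d" if d: "d \<in> K J" for d
    proof (cases "d = 0")
      case True then show ?thesis by (simp add: G_def)
    next
      case False
      then have "d /\<^sub>R norm d \<in> K J \<inter> sphere 0 1"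
        using d by (auto simp: K_def mult_le_0_iff)
      then have "c \<le> G J (d /\<^sub>R norm d)" using c by blast
      also have "\<dots> = G J d / norm d"
        unfolding G_def sum_divide_distrib
          by (intro sum.cong) (auto simp: max_def divide_inverse zero_le_mult_iff)
      finally show ?thesis using False by (simp add: field_simps)
    qed
    then show ?thesis using c by blast
  qed
  then obtain cs where cs: "\<And>J. J \<subseteq> I \<Longrightarrow> cs J > 0"
      "\<And>J d. J \<subseteq> I \<Longrightarrow> d \<in> K J \<Longrightarrow> cs J * norm d \<le> G J d"
    by metis
  define c where "c = Min (cs ` Pow I)"
  have c0: "c > 0" unfolding c_def using cs \<open>finite I\<close> by (subst Min_gr_iff) auto
  have "P = (\<Inter>i\<in>I. {x. a i \<bullet> x \<le> \<beta> i})" using P by auto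
  then have "closed P" "convex P"
    by (auto intro!: closed_INT closed_halfspace_le convex_INT convex_halfspace_le)
  have "infdist z P \<le> 1 / c * (\<Sum>i\<in>I. max 0 (a i \<bullet> z - \<beta> i))" for z
  proof -
    define p where "p = closest_point P z"
    define d where "d = z - p"
    define J where "J = {i\<in>I. a i \<bullet> p = \<beta> i}"
    have "J \<subseteq> I" by (auto simp: J_def)
    have pP: "p \<in> P" using \<open>closed P\<close> ne by (simp add: p_def closest_point_in_set)
    \<comment> \<open>A short step from \<open>p\<close> along \<open>e\<close> stays in
      \<open>P\<close>: active constraints allow it by sign, inactive ones by slack. The variational
      inequality of the projection then applies to the moved point.\<close>
    have "e \<bullet> d \<le> 0" if e: "\<forall>i\<in>J. a i \<bullet> e \<le> 0" for e
    proof -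
      have "\<forall>\<^sub>F t in at_right 0. a i \<bullet> (p + t *\<^sub>R e) \<le> \<beta> i" if i: "i \<in> I" for i
      proof (cases "i \<in> J")
        case True
        have "\<forall>\<^sub>F t in at_right (0::real). 0 < t" by (simp add: eventually_at_right_less)
        then show ?thesis
          by eventually_elim (use True e in \<open>auto simp: J_def inner_add_right mult_nonneg_nonpos\<close>)
      next
        case False
        then have "a i \<bullet> p < \<beta> i" using i pP P by (auto simp: J_def)
        moreover have "((\<lambda>t. a i \<bullet> (p + t *\<^sub>R e)) \<longlongrightarrow> a i \<bullet> (p + 0 *\<^sub>R e)) (at_right 0)"
          by (intro tendsto_intros)
        ultimately have "\<forall>\<^sub>F t in at_right 0. a i \<bullet> (p + t *\<^sub>R e) < \<beta> i"
          by (intro order_tendstoD(2)) auto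
        then show ?thesis by eventually_elim simp
      qed
      then have "\<forall>\<^sub>F t in at_right (0::real). \<forall>i\<in>I. a i \<bullet> (p + t *\<^sub>R e) \<le> \<beta> i"
        using \<open>finite I\<close> by (intro eventually_ball_finite) auto
      moreover have "\<forall>\<^sub>F t in at_right (0::real). 0 < t" by (simp add: eventually_at_right_less)
      ultimately have "\<forall>\<^sub>F t in at_right (0::real). 0 < t \<and> p + t *\<^sub>R e \<in> P"
        by eventually_elim (auto simp: P)
      then obtain t where "0 < t" "p + t *\<^sub>R e \<in> P"
        using eventually_happens[of _ "at_right (0::real)"] by (auto simp: trivial_limit_at_right_real)
      then have "d \<bullet> (t *\<^sub>R e) \<le> 0"
        using closest_point_dot[OF \<open>convex P\<close> \<open>closed P\<close>, of "p + t *\<^sub>R e" z] by (simp add: d_def p_def)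
      then show ?thesis using \<open>0 < t\<close> by (simp add: mult_le_0_iff inner_commute)
    qed
    then have "d \<in> K J" by (simp add: K_def)
    have "c \<le> cs J" unfolding c_def using \<open>finite I\<close> \<open>J \<subseteq> I\<close> by (intro Min_le) auto
    then have "c * norm d \<le> cs J * norm d" by (simp add: mult_right_mono)
    also have "\<dots> \<le> G J d" using cs \<open>J \<subseteq> I\<close> \<open>d \<in> K J\<close> by blast
    \<comment> \<open>On \<open>J\<close> the bound \<open>\<beta> i\<close> equals
      \<open>a i \<bullet> p\<close>, so the homogeneous violation by \<open>z - p\<close> is the
      violation by \<open>z\<close>.\<close>
    also have "\<dots> = (\<Sum>i\<in>J. max 0 (a i \<bullet> z - \<beta> i))"
      unfolding G_def d_def by (intro sum.cong) (auto simp: J_def inner_diff_right)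
    also have "\<dots> \<le> (\<Sum>i\<in>I. max 0 (a i \<bullet> z - \<beta> i))"
      using \<open>finite I\<close> \<open>J \<subseteq> I\<close> by (intro sum_mono2) auto
    finally have "norm d \<le> 1 / c * (\<Sum>i\<in>I. max 0 (a i \<bullet> z - \<beta> i))"
      using c0 by (simp add: field_simps)
    moreover have "infdist z P \<le> norm d" using infdist_le[OF pP, of z] by (simp add: d_def dist_norm)
    ultimately show ?thesis by simp
  qed
  then show ?thesis using that[of "1 / c"] c0 by simp
qed

section \<open>Proximal steps\<close>

lemma minimizers_iff: "x \<in> minimizers f \<longleftrightarrow> (\<forall>y. f x \<le> (f y :: real))"
  by (auto simp: minimizers_def is_arg_min_linorder)

text \<open>A supporting hyperplane at the intermediate point is evaluated at both ends and
  averaged; the linear terms cancel. This suits an objective whose subgradients are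
  explicit.\<close>

lemma convex_on_if_subdifferential_nonempty:
  fixes f :: "'a::real_inner \<Rightarrow> real"
  assumes "\<And>x. subdifferential f x \<noteq> {}"
  shows "convex_on UNIV f"
proof (rule convex_onI)
  fix t :: real and x y :: 'a
  assume t: "0 < t" "t < 1"
  let ?z = "(1 - t) *\<^sub>R x + t *\<^sub>R y"
  obtain g where g: "\<And>y. f ?z + g \<bullet> (y - ?z) \<le> f y"
    using assms[of ?z] by (auto simp: subdifferential_def)
  have "(1 - t) * (f ?z + g \<bullet> (x - ?z)) + t * (f ?z + g \<bullet> (y - ?z)) \<le> (1 - t) * f x + t * f y"
    using t g by (intro add_mono mult_left_mono) auto
  then show "f ?z \<le> (1 - t) * f x + t * f y"
    by (simp add: inner_diff_right inner_add_right algebra_simps)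
qed auto

text \<open>Comparing \<open>x\<close> with \<open>x + t (y - x)\<close> and using convexity of
  \<open>F\<close>, everything is divisible by \<open>t\<close>; the quadratic remainder disappears
  as \<open>t\<close> tends to 0 from the right. This is the optimality condition obtained without a
  sum rule for subdifferentials.\<close>

lemma prox_subgradient:
  fixes F :: "'a::euclidean_space \<Rightarrow> real" and L :: "'a \<Rightarrow> 'b::real_inner"
  assumes conv: "convex_on UNIV F" and L: "linear L" and s: "0 < s"
    and x: "x \<in> minimizers (\<lambda>y. F y + 1 / (2 * s) * (norm (L y - L z))\<^sup>2)"
  shows "F x + 1 / s * (L (z - x) \<bullet> L (y - x)) \<le> F y"
proof -
  let ?d = "y - x"
  have quad: "(norm (L (x + t *\<^sub>R ?d) - L z))\<^sup>2
      = (norm (L x - L z))\<^sup>2 - 2 * t * (L (z - x) \<bullet> L ?d) + t\<^sup>2 * (norm (L ?d))\<^sup>2" for t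
    unfolding power2_norm_eq_inner linear_add[OF L] linear_diff[OF L] linear_cmul[OF L]
    by (simp add: algebra_simps inner_commute power2_eq_square)
  have "\<forall>\<^sub>F t in at_right 0. 0 \<le> F y - F x - 1 / s * (L (z - x) \<bullet> L ?d) + t / (2 * s) * (norm (L ?d))\<^sup>2"
    unfolding eventually_at_right_field
  proof (intro exI[of _ 1] conjI allI impI)
    fix t :: real assume t: "0 < t" "t < 1"
    have "F (x + t *\<^sub>R ?d) \<le> (1 - t) * F x + t * F y"
      using convex_onD[OF conv, of t x y] t by (simp add: algebra_simps)
    moreover have "F x + 1 / (2 * s) * (norm (L x - L z))\<^sup>2
        \<le> F (x + t *\<^sub>R ?d) + 1 / (2 * s) * (norm (L (x + t *\<^sub>R ?d) - L z))\<^sup>2"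
      using x by (simp add: minimizers_iff)
    moreover have "1 / (2 * s) * (norm (L (x + t *\<^sub>R ?d) - L z))\<^sup>2 = 1 / (2 * s) * (norm (L x - L z))\<^sup>2
        + t * (t / (2 * s) * (norm (L ?d))\<^sup>2 - 1 / s * (L (z - x) \<bullet> L ?d))"
      unfolding quad using s by (simp add: field_simps power2_eq_square)
    ultimately have "0 \<le> t * (F y - F x - 1 / s * (L (z - x) \<bullet> L ?d) + t / (2 * s) * (norm (L ?d))\<^sup>2)"
      by (simp only: distrib_left right_diff_distrib left_diff_distrib mult_1_left)
    then show "0 \<le> F y - F x - 1 / s * (L (z - x) \<bullet> L ?d) + t / (2 * s) * (norm (L ?d))\<^sup>2"
      using t by (simp add: zero_le_mult_iff)
  qed auto
  moreover have "((\<lambda>t. F y - F x - 1 / s * (L (z - x) \<bullet> L ?d) + t / (2 * s) * (norm (L ?d))\<^sup>2)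
      \<longlongrightarrow> F y - F x - 1 / s * (L (z - x) \<bullet> L ?d) + 0 / (2 * s) * (norm (L ?d))\<^sup>2) (at_right 0)"
    using s by (intro tendsto_intros) auto
  ultimately have "0 \<le> F y - F x - 1 / s * (L (z - x) \<bullet> L ?d) + 0 / (2 * s) * (norm (L ?d))\<^sup>2"
    by (intro tendsto_lowerbound) auto
  then show ?thesis by simp
qed

text \<open>At a minimizer \<open>p\<close> the subgradient inequality forces a nonpositive inner
  product of \<open>L (z - x)\<close> and \<open>L (p - x)\<close>, and expanding the squares gives
  the Pythagorean inequality.\<close>

lemma prox_fejer:
  fixes F :: "'a::euclidean_space \<Rightarrow> real" and L :: "'a \<Rightarrow> 'b::real_inner"
  assumes "convex_on UNIV F" and L: "linear L" and s: "0 < s"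
    and x: "x \<in> minimizers (\<lambda>y. F y + 1 / (2 * s) * (norm (L y - L z))\<^sup>2)"
    and p: "p \<in> minimizers F"
  shows "(norm (L x - L p))\<^sup>2 + (norm (L z - L x))\<^sup>2 \<le> (norm (L z - L p))\<^sup>2"
proof -
  have "F x + 1 / s * (L (z - x) \<bullet> L (p - x)) \<le> F p"
    using assms prox_subgradient by blast
  moreover have "F p \<le> F x" using p by (simp add: minimizers_iff)
  ultimately have "1 / s * (L (z - x) \<bullet> L (p - x)) \<le> 0" by simp
  then have "L (z - x) \<bullet> L (p - x) \<le> 0" using s by (simp add: field_simps)
  then show ?thesis
    by (simp add: linear_diff[OF L] power2_norm_eq_inner algebra_simps inner_commute)
qed

text \<open>The penalty makes the problem coercive because \<open>F\<close> is nonnegative and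
  \<open>L\<close> is injective. For uniqueness, the subgradient inequalities at two minimizers,
  each tested at the other, are added.\<close>

lemma ex1_prox:
  fixes F :: "'a::euclidean_space \<Rightarrow> real" and L :: "'a \<Rightarrow> 'b::euclidean_space"
  assumes conv: "convex_on UNIV F" and cont: "continuous_on UNIV F" and F0: "\<And>x. 0 \<le> F x"
    and L: "linear L" "inj L" and s: "0 < s"
  shows "\<exists>!x. x \<in> minimizers (\<lambda>y. F y + 1 / (2 * s) * (norm (L y - L z))\<^sup>2)"
proof (rule ex_ex1I)
  let ?Q = "\<lambda>y. F y + 1 / (2 * s) * (norm (L y - L z))\<^sup>2"
  obtain B where B: "B > 0" "\<And>x. B * norm x \<le> norm (L x)"
    using linear_inj_bounded_below_pos[OF L] by metis
  \<comment> \<open>Outside the ball of this radius the penalty alone exceeds \<open>F z\<close>,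
    which is the value of \<open>?Q\<close> at the centre.\<close>
  define r where "r = sqrt (2 * s * F z) / B"
  have contQ: "continuous_on UNIV ?Q"
    using cont linear_continuous_on[OF L(1)[unfolded linear_conv_bounded_linear]]
    by (intro continuous_intros) auto
  have r0: "0 \<le> r" using F0 s B by (simp add: r_def)
  have "\<exists>x\<in>cball z r. \<forall>y\<in>cball z r. ?Q x \<le> ?Q y"
    using r0 by (intro continuous_attains_inf continuous_on_subset[OF contQ]) auto
  then obtain x where x: "\<And>y. y \<in> cball z r \<Longrightarrow> ?Q x \<le> ?Q y" by blast
  have "?Q x \<le> ?Q y" for y
  proof (cases "y \<in> cball z r")
    case False
    then have "sqrt (2 * s * F z) < B * norm (y - z)"
      using B by (simp add: r_def field_simps dist_norm norm_minus_commute)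
    also have "\<dots> \<le> norm (L y - L z)" using B by (simp add: linear_diff[OF L(1), symmetric])
    finally have "(sqrt (2 * s * F z))\<^sup>2 < (norm (L y - L z))\<^sup>2"
      using F0 s by (intro power_strict_mono) auto
    then have "F z < 1 / (2 * s) * (norm (L y - L z))\<^sup>2"
      using F0 s by (simp add: field_simps)
    then have "?Q z \<le> ?Q y" using F0[of y] by simp
    then show ?thesis using x[of z] r0 by fastforce
  qed (use x in auto)
  then show "\<exists>x. x \<in> minimizers ?Q" by (auto simp: minimizers_iff)
next
  fix x x'
  assume "x \<in> minimizers (\<lambda>y. F y + 1 / (2 * s) * (norm (L y - L z))\<^sup>2)"
    and "x' \<in> minimizers (\<lambda>y. F y + 1 / (2 * s) * (norm (L y - L z))\<^sup>2)"
  then have "F x + 1 / s * (L (z - x) \<bullet> L (x' - x)) \<le> F x'"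
    and "F x' + 1 / s * (L (z - x') \<bullet> L (x - x')) \<le> F x"
    using prox_subgradient[OF conv L(1) s] by blast+
  then have "1 / s * (L (z - x) \<bullet> L (x' - x) + L (z - x') \<bullet> L (x - x')) \<le> 0"
    by (simp add: distrib_left)
  then have "L (z - x) \<bullet> L (x' - x) + L (z - x') \<bullet> L (x - x') \<le> 0"
    using s by (simp add: field_simps)
  then have "(norm (L x - L x'))\<^sup>2 \<le> 0"
    by (simp add: linear_diff[OF L(1)] power2_norm_eq_inner algebra_simps inner_commute)
  then show "x = x'" using L(2) by (simp add: inj_eq)
qed

text \<open>Subtracting the partial sums of \<open>e\<close> leaves a decreasing sequence that is
  bounded below by \<open>- suminf e\<close>.\<close>

lemma quasi_fejer_convergent:
  fixes a e :: "nat \<Rightarrow> real"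
  assumes a: "\<And>k. 0 \<le> a k" and step: "\<And>k. a (Suc k) \<le> a k + e k"
    and e: "\<And>k. 0 \<le> e k" "summable e"
  shows "convergent a"
proof -
  let ?b = "\<lambda>k. a k - sum e {..<k}"
  have "decseq ?b" using step by (intro decseq_SucI) (auto simp: algebra_simps)
  moreover have "- suminf e \<le> ?b k" for k
    using a[of k] sum_le_suminf[OF e(2), of "{..<k}"] e(1) by fastforce
  ultimately have "convergent ?b" by (blast intro: decseq_convergent convergentI)
  moreover have "convergent (\<lambda>k. sum e {..<k})" using e(2) summable_iff_convergent by blast
  ultimately have "convergent (\<lambda>k. ?b k + sum e {..<k})" by (rule convergent_add)
  then show ?thesis by simp
qed

text \<open>The norm of \<open>scl c z\<close> is the norm of the stacked vector in the metric \<open>precond s g\<close> with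
  \<open>c = s / g\<close>.\<close>

definition scl :: "real \<Rightarrow> 'a::euclidean_space \<times> real \<Rightarrow> 'a \<times> real" where
  "scl c z = (fst z, sqrt c * snd z)"

lemma linear_scl: "linear (scl c)"
  by (rule linearI) (auto simp: scl_def algebra_simps)

lemma inj_scl: "0 < c \<Longrightarrow> inj (scl c)"
  by (auto simp: inj_def scl_def prod_eq_iff)

lemma norm_scl_sq: "0 \<le> c \<Longrightarrow> (norm (scl c z))\<^sup>2 = (norm (fst z))\<^sup>2 + c * (snd z)\<^sup>2"
  by (simp add: scl_def norm_Pair power_mult_distrib)

lemma inner_scl:
  assumes "0 \<le> c" shows "scl c x \<bullet> scl c y = fst x \<bullet> fst y + c * (snd x * snd y)"
proof -
  have "sqrt c * snd x * (sqrt c * snd y) = (sqrt c * sqrt c) * (snd x * snd y)" by (simp only: mult_ac)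
  then show ?thesis using assms by (simp add: scl_def)
qed

lemma dist_scl: "dist (scl c x) (scl c y) = norm (scl c (x - y))"
  by (simp add: dist_norm linear_diff[OF linear_scl])

lemma norm_scl_mono:
  assumes "0 \<le> c'" "c' \<le> c" shows "norm (scl c' z) \<le> norm (scl c z)"
proof (rule power2_le_imp_le)
  show "(norm (scl c' z))\<^sup>2 \<le> (norm (scl c z))\<^sup>2"
    using assms by (simp add: norm_scl_sq mult_right_mono)
qed simp

lemma norm_sq_pair: "(norm z)\<^sup>2 = (norm (fst z))\<^sup>2 + (snd z)\<^sup>2" for z :: "'a::euclidean_space \<times> real"
  by (cases z) (simp add: norm_Pair)

lemma norm_scl_le:
  assumes "0 \<le> c" shows "norm (scl c z) \<le> sqrt (max 1 c) * norm z"
proof (rule power2_le_imp_le)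
  have "1 * (norm (fst z))\<^sup>2 + c * (snd z)\<^sup>2 \<le> max 1 c * (norm (fst z))\<^sup>2 + max 1 c * (snd z)\<^sup>2"
    by (intro add_mono mult_right_mono) auto
  then show "(norm (scl c z))\<^sup>2 \<le> (sqrt (max 1 c) * norm z)\<^sup>2"
    using assms by (simp add: norm_scl_sq power_mult_distrib norm_sq_pair[of z] distrib_left)
qed (auto simp: assms)

lemma norm_le_scl:
  assumes "0 \<le> c" shows "sqrt (min 1 c) * norm z \<le> norm (scl c z)"
proof (rule power2_le_imp_le)
  have "min 1 c * (norm (fst z))\<^sup>2 + min 1 c * (snd z)\<^sup>2 \<le> 1 * (norm (fst z))\<^sup>2 + c * (snd z)\<^sup>2"
    by (intro add_mono mult_right_mono) auto
  then show "(sqrt (min 1 c) * norm z)\<^sup>2 \<le> (norm (scl c z))\<^sup>2"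
    using assms by (simp add: norm_scl_sq power_mult_distrib norm_sq_pair[of z] distrib_left)
qed auto

text \<open>Scaling twice multiplies by the full weight \<open>c\<close>, so the left side is the
  norm of the metric applied to \<open>z\<close>, the quantity occurring in the proximal
  residual.\<close>

lemma norm_weighted_le_scl:
  assumes "0 \<le> c" shows "norm (fst z, c * snd z) \<le> sqrt (max 1 c) * norm (scl c z)"
proof -
  have "scl c (scl c z) = (fst z, c * snd z)" using assms by (simp add: scl_def mult.assoc[symmetric])
  then show ?thesis using norm_scl_le[OF assms, of "scl c z"] by simp
qed

section \<open>Distances to a set in the weighted norms\<close>

lemma infdist_greatest:
  assumes "S \<noteq> {}" "\<And>y. y \<in> S \<Longrightarrow> d \<le> dist x y" shows "d \<le> infdist x S"
  using assms by (simp add: infdist_notempty cINF_greatest)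

text \<open>This absorbs the change of metric between consecutive iterations.\<close>

lemma infdist_scl_mono:
  assumes "0 \<le> c'" "c' \<le> c"
  shows "infdist (scl c' z) (scl c' ` S) \<le> infdist (scl c z) (scl c ` S)"
proof (cases "S = {}")
  case False
  have "infdist (scl c' z) (scl c' ` S) \<le> dist (scl c z) (scl c y)" if "y \<in> S" for y
    using infdist_le[of "scl c' y" "scl c' ` S" "scl c' z"] norm_scl_mono[OF assms, of "z - y"] that
    by (simp add: dist_scl)
  then show ?thesis using False by (intro infdist_greatest) auto
qed (simp add: infdist_def)

lemma infdist_scl_le:
  assumes "0 \<le> c" shows "infdist (scl c z) (scl c ` S) \<le> sqrt (max 1 c) * infdist z S"
proof (cases "S = {}")
  case False
  have "infdist (scl c z) (scl c ` S) / sqrt (max 1 c) \<le> infdist z S"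
  proof (rule infdist_greatest[OF False])
    fix y assume "y \<in> S"
    then have "infdist (scl c z) (scl c ` S) \<le> sqrt (max 1 c) * dist z y"
      using infdist_le[of "scl c y" "scl c ` S" "scl c z"] norm_scl_le[OF assms, of "z - y"]
      by (simp add: dist_scl dist_norm[of z])
    then show "infdist (scl c z) (scl c ` S) / sqrt (max 1 c) \<le> dist z y"
      by (simp add: divide_le_eq mult.commute)
  qed
  then show ?thesis by (simp add: divide_le_eq mult.commute)
qed (simp add: infdist_def)

lemma infdist_le_scl:
  assumes "0 < c" shows "infdist z S \<le> infdist (scl c z) (scl c ` S) / sqrt (min 1 c)"
proof (cases "S = {}")
  case False
  have "sqrt (min 1 c) * infdist z S \<le> infdist (scl c z) (scl c ` S)"
  proof (rule infdist_greatest)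
    fix y' assume "y' \<in> scl c ` S"
    then obtain y where y: "y \<in> S" "y' = scl c y" by blast
    have "sqrt (min 1 c) * infdist z S \<le> sqrt (min 1 c) * dist z y"
      using y assms by (intro mult_left_mono infdist_le) auto
    also have "\<dots> \<le> dist (scl c z) y'"
      using norm_le_scl[of c "z - y"] assms y by (simp add: dist_scl dist_norm[of z])
    finally show "sqrt (min 1 c) * infdist z S \<le> dist (scl c z) y'" .
  qed (use False in auto)
  then show ?thesis using assms by (simp add: le_divide_eq mult.commute)
qed (simp add: infdist_def)

text \<open>The Fejer inequality holds for every solution \<open>p\<close>, so the infimum can be
  taken over \<open>p\<close> on the right alone. The square root turns the claim into a lower bound
  for an unsquared distance, to which \<open>infdist_greatest\<close> applies.\<close>

lemma prox_infdist_sq: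
  fixes F :: "'a::euclidean_space \<times> real \<Rightarrow> real"
  assumes "convex_on UNIV F" "0 < s" "minimizers F \<noteq> {}"
    and x: "x \<in> minimizers (\<lambda>y. F y + 1 / (2 * s) * (norm (scl c y - scl c z))\<^sup>2)"
  shows "(infdist (scl c x) (scl c ` minimizers F))\<^sup>2 + (norm (scl c z - scl c x))\<^sup>2
    \<le> (infdist (scl c z) (scl c ` minimizers F))\<^sup>2"
proof -
  let ?d = "infdist (scl c x) (scl c ` minimizers F)"
  have "sqrt (?d\<^sup>2 + (norm (scl c z - scl c x))\<^sup>2) \<le> infdist (scl c z) (scl c ` minimizers F)"
  proof (rule infdist_greatest)
    fix p' assume "p' \<in> scl c ` minimizers F"
    then obtain p where p: "p \<in> minimizers F" "p' = scl c p" by blast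
    have "?d\<^sup>2 \<le> (norm (scl c x - scl c p))\<^sup>2"
      using infdist_le[of p' "scl c ` minimizers F" "scl c x"] p
      by (intro power_mono) (auto simp: dist_norm infdist_nonneg)
    with prox_fejer[OF assms(1) linear_scl assms(2) x p(1)]
    show "sqrt (?d\<^sup>2 + (norm (scl c z - scl c x))\<^sup>2) \<le> dist (scl c z) p'"
      by (intro real_le_lsqrt) (auto simp: p dist_norm)
  qed (use assms in auto)
  from power_mono[OF this, of 2] show ?thesis by simp
qed

text \<open>Two facts combine: the error bound gives \<open>s * d \<le> \<kappa> * l * e\<close> for
  the step length \<open>e\<close>, and the Fejer inequality gives a Pythagorean relation between
  \<open>d\<close>, \<open>e\<close> and \<open>D\<close>. The factor \<open>l\<close> is a product
  of two \<open>sqrt l\<close>, one from measuring the residual in the Euclidean norm and one from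
  measuring the distance in the scaled norm.\<close>

lemma prox_rate:
  fixes F :: "'a::euclidean_space \<times> real \<Rightarrow> real"
  assumes F: "convex_on UNIV F" "minimizers F \<noteq> {}" and s: "0 < s" and c: "0 < c" and \<kappa>: "0 < \<kappa>"
    and x: "x \<in> minimizers (\<lambda>y. F y + 1 / (2 * s) * (norm (scl c y - scl c z))\<^sup>2)"
    and err: "infdist x (minimizers F) \<le> \<kappa> * infdist 0 (subdifferential F x)"
  shows "infdist (scl c x) (scl c ` minimizers F)
    \<le> \<kappa> * max 1 c / sqrt (s\<^sup>2 + \<kappa>\<^sup>2 * (max 1 c)\<^sup>2) * infdist (scl c z) (scl c ` minimizers F)"
proof -
  define l where "l = max 1 c"
  define d where "d = infdist (scl c x) (scl c ` minimizers F)"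
  define D where "D = infdist (scl c z) (scl c ` minimizers F)"
  define e where "e = norm (scl c (z - x))"
  have l: "0 < l" by (simp add: l_def)
  have nn: "0 \<le> d" "0 \<le> D" "0 \<le> e" by (simp_all add: d_def D_def e_def infdist_nonneg)
  \<comment> \<open>The proximal residual: the diagonal metric applied to \<open>z - x\<close>,
    divided by the step size.\<close>
  let ?g = "(1 / s) *\<^sub>R (fst (z - x), c * snd (z - x))"
  have "F x + ?g \<bullet> (y - x) \<le> F y" for y
  proof -
    have "F x + 1 / s * (fst (z - x) \<bullet> fst (y - x) + c * (snd (z - x) * snd (y - x))) \<le> F y"
      using prox_subgradient[OF F(1) linear_scl s x, of y] c by (simp only: inner_scl less_imp_le)
    then show ?thesis
      by (simp add: inner_prod_def mult.assoc add_divide_distrib del: scaleR_Pair fst_diff snd_diff)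
  qed
  then have "?g \<in> subdifferential F x" by (simp add: subdifferential_def)
  then have "infdist 0 (subdifferential F x) \<le> norm ?g"
    using infdist_le[of ?g _ 0] by (simp only: dist_0_norm)
  also have "\<dots> = 1 / s * norm (fst (z - x), c * snd (z - x))"
    using s by (simp del: scaleR_Pair)
  also have "\<dots> \<le> 1 / s * (sqrt l * e)"
    using norm_weighted_le_scl[of c "z - x"] c s unfolding l_def e_def by (intro mult_left_mono) auto
  finally have sub: "infdist 0 (subdifferential F x) \<le> 1 / s * (sqrt l * e)" .
  have "d \<le> sqrt l * infdist x (minimizers F)"
    unfolding d_def l_def using c by (intro infdist_scl_le) auto
  also have "\<dots> \<le> sqrt l * (\<kappa> * (1 / s * (sqrt l * e)))"
    using \<kappa> l by (intro mult_left_mono order_trans[OF err mult_left_mono[OF sub]]) auto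
  also have "\<dots> = \<kappa> * (sqrt l * sqrt l) / s * e" by simp
  also have "\<dots> = \<kappa> * l / s * e" using l by simp
  finally have "s * d \<le> \<kappa> * l * e" using s by (simp add: field_simps)
  then have "(s * d)\<^sup>2 \<le> (\<kappa> * l * e)\<^sup>2" using s nn by (intro power_mono) auto
  moreover have "d\<^sup>2 + e\<^sup>2 \<le> D\<^sup>2"
    using prox_infdist_sq[OF F(1) s F(2) x]
    by (simp add: d_def D_def e_def linear_diff[OF linear_scl])
  \<comment> \<open>With this factor the term in \<open>e\<close> cancels against the squared error
    bound.\<close>
  then have "(\<kappa> * l)\<^sup>2 * (d\<^sup>2 + e\<^sup>2) \<le> (\<kappa> * l)\<^sup>2 * D\<^sup>2" by (intro mult_left_mono) auto
  ultimately have "(s\<^sup>2 + \<kappa>\<^sup>2 * l\<^sup>2) * d\<^sup>2 \<le> (\<kappa> * l * D)\<^sup>2"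
    by (simp add: power_mult_distrib algebra_simps)
  then have "(sqrt (s\<^sup>2 + \<kappa>\<^sup>2 * l\<^sup>2) * d)\<^sup>2 \<le> (\<kappa> * l * D)\<^sup>2" by (simp add: power_mult_distrib)
  then have "sqrt (s\<^sup>2 + \<kappa>\<^sup>2 * l\<^sup>2) * d \<le> \<kappa> * l * D"
    by (rule power2_le_imp_le) (use nn l \<kappa> in simp)
  moreover have "0 < sqrt (s\<^sup>2 + \<kappa>\<^sup>2 * l\<^sup>2)" using s by (simp add: add_pos_nonneg)
  ultimately have "d \<le> \<kappa> * l / sqrt (s\<^sup>2 + \<kappa>\<^sup>2 * l\<^sup>2) * D" by (simp add: field_simps)
  then show ?thesis by (simp add: d_def D_def l_def)
qed

section \<open>The inexact proximal point method with variable metric\<close>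

text \<open>\<open>x k\<close> is the exact proximal point of the computed iterate
  \<open>z k\<close>, and \<open>c k\<close> is the only nontrivial weight of the metric. The lower
  bound \<open>c0\<close> is an explicit parameter because it converts scaled radii into a Euclidean
  radius valid for all \<open>k\<close>.\<close>

locale inexact_ppa =
  fixes F :: "'a::euclidean_space \<times> real \<Rightarrow> real" and c s \<epsilon> :: "nat \<Rightarrow> real" and c0 s0 :: real
    and z x :: "nat \<Rightarrow> 'a \<times> real"
  assumes conv: "convex_on UNIV F" and cont: "continuous_on UNIV F" and ne: "minimizers F \<noteq> {}"
    and bdd: "bounded (minimizers F)"
    and c0: "0 < c0" "\<And>k. c0 \<le> c k" and c_decr: "decseq c"
    and s0: "0 < s0" "\<And>k. s0 \<le> s k"
    and \<epsilon>0: "\<And>k. 0 \<le> \<epsilon> k" and \<epsilon>_sum: "summable \<epsilon>"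
    and prox: "\<And>k. x k \<in> minimizers (\<lambda>y. F y + 1 / (2 * s k) * (norm (scl (c k) y - scl (c k) (z k)))\<^sup>2)"
    and inexact: "\<And>k. norm (scl (c k) (z (Suc k)) - scl (c k) (x k)) \<le> \<epsilon> k"
begin

abbreviation "D k y \<equiv> infdist (scl (c k) y) (scl (c k) ` minimizers F)"

lemma pos: "0 < c k" "0 < s k"
  using c0 s0 less_le_trans by blast+

lemma c_Suc: "c (Suc k) \<le> c k"
  using c_decr by (simp add: decseq_Suc_iff)

lemma prox_infdist_le: "D k (x k) \<le> D k (z k)"
proof (rule power2_le_imp_le)
  show "(D k (x k))\<^sup>2 \<le> (D k (z k))\<^sup>2"
    using prox_infdist_sq[OF conv pos(2) ne prox, of k]
      zero_le_power2[of "norm (scl (c k) (z k) - scl (c k) (x k))"] by linarith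
qed (rule infdist_nonneg)

lemma infdist_step: "D (Suc k) (z (Suc k)) \<le> D k (z k) + \<epsilon> k"
proof -
  have "D (Suc k) (z (Suc k)) \<le> D k (z (Suc k))"
    using infdist_scl_mono[OF less_imp_le[OF pos(1)] c_Suc] .
  also have "\<dots> \<le> D k (x k) + norm (scl (c k) (z (Suc k)) - scl (c k) (x k))"
    unfolding dist_norm[symmetric] by (rule infdist_triangle)
  finally show ?thesis using prox_infdist_le[of k] inexact[of k] by linarith
qed

lemma infdist_bound: "D k (z k) \<le> D 0 (z 0) + suminf \<epsilon>"
proof -
  have "D k (z k) \<le> D 0 (z 0) + sum \<epsilon> {..<k}"
  proof (induction k)
    case (Suc k)
    then show ?case using infdist_step[of k] by simp
  qed simp
  moreover have "sum \<epsilon> {..<k} \<le> suminf \<epsilon>" using \<epsilon>_sum \<epsilon>0 by (intro sum_le_suminf) auto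
  ultimately show ?thesis by simp
qed

text \<open>The point \<open>y\<close> is arbitrary because the estimate serves both the iterates
  and the exact proximal points.\<close>

lemma infdist_le_radius:
  assumes "D k y \<le> D 0 (z 0) + suminf \<epsilon>"
  shows "infdist y (minimizers F) \<le> (D 0 (z 0) + suminf \<epsilon>) / sqrt (min 1 c0)"
proof -
  have "infdist y (minimizers F) \<le> D k y / sqrt (min 1 (c k))" using infdist_le_scl[OF pos(1)] .
  also have "\<dots> \<le> D k y / sqrt (min 1 c0)"
    using c0(1) c0(2)[of k] pos[of k] by (intro divide_left_mono) (auto simp: infdist_nonneg)
  also have "\<dots> \<le> (D 0 (z 0) + suminf \<epsilon>) / sqrt (min 1 c0)"
    using assms c0 by (intro divide_right_mono) auto
  finally show ?thesis .
qed

text \<open>The minimizers form the sublevel set at the optimal value, which is closed by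
  continuity.\<close>

lemma compact_minimizers: "compact (minimizers F)"
proof -
  obtain p where p: "p \<in> minimizers F" using ne by blast
  have "minimizers F = UNIV \<inter> F -` {..F p}"
  proof (intro set_eqI iffI)
    fix y assume "y \<in> minimizers F"
    then show "y \<in> UNIV \<inter> F -` {..F p}" using minimizers_iff[of y F] by blast
  next
    fix y assume "y \<in> UNIV \<inter> F -` {..F p}"
    then have "F y \<le> F q" for q using minimizers_iff[of p F] p order_trans[of "F y" "F p" "F q"] by blast
    then show "y \<in> minimizers F" using minimizers_iff[of y F] by blast
  qed
  moreover have "closed (UNIV \<inter> F -` {..F p})" using cont by (intro continuous_closed_preimage) auto
  ultimately show ?thesis using bdd compact_eq_bounded_closed by metis
qed

lemma bounded_iterates: "bounded (range z)"
proof -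
  have "range z \<subseteq> {y. infdist y (minimizers F) \<le> (D 0 (z 0) + suminf \<epsilon>) / sqrt (min 1 c0)}"
    using infdist_le_radius infdist_bound by blast
  \<comment> \<open>The radius itself may be 0; adding 1 gives the positive radius that
    \<open>compact_infdist_le\<close> asks for.\<close>
  moreover have "0 < (D 0 (z 0) + suminf \<epsilon>) / sqrt (min 1 c0) + 1"
    using c0 \<epsilon>0 \<epsilon>_sum by (intro add_nonneg_pos) (auto simp: infdist_nonneg suminf_nonneg)
  then have "compact {y. infdist y (minimizers F) \<le> (D 0 (z 0) + suminf \<epsilon>) / sqrt (min 1 c0) + 1}"
    using compact_minimizers ne by (intro compact_infdist_le)
  ultimately show ?thesis by (elim bounded_subset[OF compact_imp_bounded]) auto
qed

text \<open>The passage from \<open>z k\<close> to \<open>z (Suc k)\<close> is split at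
  \<open>x k\<close>: the exact step is nonexpansive towards \<open>p\<close> with a gain of the
  squared residual, and only the second half costs \<open>\<epsilon> k\<close>.\<close>

lemma fejer_step:
  assumes "p \<in> minimizers F"
  shows "norm (scl (c (Suc k)) (z (Suc k) - p)) \<le> norm (scl (c k) (x k - p)) + \<epsilon> k"
    and "norm (scl (c k) (x k - p)) \<le> norm (scl (c k) (z k - p))"
    and "(norm (scl (c k) (z k - x k)))\<^sup>2 \<le> (norm (scl (c k) (z k - p)))\<^sup>2 - (norm (scl (c k) (x k - p)))\<^sup>2"
proof -
  have "norm (scl (c (Suc k)) (z (Suc k) - p)) \<le> norm (scl (c k) (z (Suc k) - p))"
    using norm_scl_mono[OF less_imp_le[OF pos(1)] c_Suc] .
  also have "\<dots> \<le> norm (scl (c k) (z (Suc k) - x k)) + norm (scl (c k) (x k - p))"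
    using norm_triangle_ineq[of "scl (c k) (z (Suc k) - x k)" "scl (c k) (x k - p)"]
    by (simp add: linear_diff[OF linear_scl])
  finally show "norm (scl (c (Suc k)) (z (Suc k) - p)) \<le> norm (scl (c k) (x k - p)) + \<epsilon> k"
    using inexact[of k] by (simp add: linear_diff[OF linear_scl])
  show 3: "(norm (scl (c k) (z k - x k)))\<^sup>2 \<le> (norm (scl (c k) (z k - p)))\<^sup>2 - (norm (scl (c k) (x k - p)))\<^sup>2"
    using prox_fejer[OF conv linear_scl pos(2) prox assms, of k] by (simp add: linear_diff[OF linear_scl])
  have "(norm (scl (c k) (x k - p)))\<^sup>2 \<le> (norm (scl (c k) (z k - p)))\<^sup>2"
    using 3 zero_le_power2[of "norm (scl (c k) (z k - x k))"] by linarith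
  then show "norm (scl (c k) (x k - p)) \<le> norm (scl (c k) (z k - p))"
    by (rule power2_le_imp_le) simp
qed

lemma convergent_norm:
  assumes "p \<in> minimizers F"
  shows "convergent (\<lambda>k. norm (scl (c k) (z k - p)))"
proof (rule quasi_fejer_convergent[OF _ _ \<epsilon>0 \<epsilon>_sum])
  show "norm (scl (c (Suc k)) (z (Suc k) - p)) \<le> norm (scl (c k) (z k - p)) + \<epsilon> k" for k
    using fejer_step(1,2)[OF assms, of k] by linarith
qed simp

text \<open>The distances of \<open>z k\<close> and of \<open>x k\<close> to a solution are squeezed
  to the same limit, and the difference of their squares dominates the squared residual.\<close>

lemma scaled_residual_tendsto_0: "(\<lambda>k. norm (scl (c k) (z k - x k))) \<longlonglongrightarrow> 0"
proof -
  obtain p where p: "p \<in> minimizers F" using ne by blast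
  let ?a = "\<lambda>k. norm (scl (c k) (z k - p))" and ?b = "\<lambda>k. norm (scl (c k) (x k - p))"
  obtain l where l: "?a \<longlonglongrightarrow> l" using convergent_norm[OF p] by (auto simp: convergent_def)
  have "(\<lambda>k. ?a (Suc k) - \<epsilon> k) \<longlonglongrightarrow> l - 0"
    using LIMSEQ_Suc[OF l] \<epsilon>_sum by (intro tendsto_diff summable_LIMSEQ_zero)
  then have "?b \<longlonglongrightarrow> l"
    using l by (intro tendsto_sandwich[of "\<lambda>k. ?a (Suc k) - \<epsilon> k" ?b sequentially ?a])
      (use fejer_step(1,2)[OF p] in \<open>auto simp: algebra_simps\<close>)
  then have "(\<lambda>k. (?a k)\<^sup>2 - (?b k)\<^sup>2) \<longlonglongrightarrow> l\<^sup>2 - l\<^sup>2" using l by (intro tendsto_intros)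
  then have "(\<lambda>k. (?a k)\<^sup>2 - (?b k)\<^sup>2) \<longlonglongrightarrow> 0" by simp
  then have "(\<lambda>k. (norm (scl (c k) (z k - x k)))\<^sup>2) \<longlonglongrightarrow> 0"
    by (rule tendsto_sandwich[rotated 2, OF tendsto_const]) (use fejer_step(3)[OF p] in auto)
  then have "(\<lambda>k. sqrt ((norm (scl (c k) (z k - x k)))\<^sup>2)) \<longlonglongrightarrow> sqrt 0" by (intro tendsto_real_sqrt)
  then show ?thesis by simp
qed

lemma residual_tendsto_0: "(\<lambda>k. z k - x k) \<longlonglongrightarrow> 0"
proof (rule Lim_null_comparison)
  have "norm (z k - x k) \<le> norm (scl (c k) (z k - x k)) / sqrt (min 1 c0)" for k
  proof -
    have "sqrt (min 1 c0) * norm (z k - x k) \<le> norm (scl c0 (z k - x k))"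
      using c0 by (intro norm_le_scl) auto
    also have "\<dots> \<le> norm (scl (c k) (z k - x k))" using c0 by (intro norm_scl_mono) auto
    finally show ?thesis using c0 by (simp add: le_divide_eq mult.commute)
  qed
  then show "\<forall>\<^sub>F k in sequentially. norm (z k - x k) \<le> norm (scl (c k) (z k - x k)) / sqrt (min 1 c0)"
    by simp
  have "(\<lambda>k. norm (scl (c k) (z k - x k)) / sqrt (min 1 c0)) \<longlonglongrightarrow> 0 / sqrt (min 1 c0)"
    using c0 by (intro tendsto_divide scaled_residual_tendsto_0 tendsto_const) auto
  then show "(\<lambda>k. norm (scl (c k) (z k - x k)) / sqrt (min 1 c0)) \<longlonglongrightarrow> 0" by simp
qed

text \<open>Along the subsequence the exact proximal points have the same limit \<open>q\<close>.
  Their subgradient inequality differs from optimality only by a term that vanishes with the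
  residual, so continuity of \<open>F\<close> passes it to \<open>q\<close>.\<close>

lemma cluster_point_minimizer:
  assumes "strict_mono \<rho>" and lim: "(z \<circ> \<rho>) \<longlonglongrightarrow> q"
  shows "q \<in> minimizers F"
  unfolding minimizers_iff
proof
  fix y
  have xlim: "(\<lambda>k. x (\<rho> k)) \<longlonglongrightarrow> q"
    using tendsto_diff[OF lim LIMSEQ_subseq_LIMSEQ[OF residual_tendsto_0 assms(1)]] by (simp add: o_def)
  define e where "e k = 1 / s k * (scl (c k) (z k - x k) \<bullet> scl (c k) (y - x k))" for k
  \<comment> \<open>Step sizes are at least \<open>s0\<close> and no weight exceeds
    \<open>c 0\<close>, so this factor works for every \<open>k\<close>.\<close>
  let ?m = "1 / s0 * sqrt (max 1 (c 0))"
  have bound: "\<bar>e k\<bar> \<le> norm (scl (c k) (z k - x k)) * (?m * norm (y - x k))" for k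
  proof -
    have "norm (scl (c k) (y - x k)) \<le> norm (scl (c 0) (y - x k))"
      using decseqD[OF c_decr, of 0 k] pos[of k] by (intro norm_scl_mono) auto
    also have "\<dots> \<le> sqrt (max 1 (c 0)) * norm (y - x k)"
      using pos[of 0] by (intro norm_scl_le) auto
    finally have 1: "norm (scl (c k) (y - x k)) \<le> sqrt (max 1 (c 0)) * norm (y - x k)" .
    have "\<bar>e k\<bar> = 1 / s k * \<bar>scl (c k) (z k - x k) \<bullet> scl (c k) (y - x k)\<bar>"
      using pos[of k] by (simp add: e_def abs_mult)
    also have "\<dots> \<le> 1 / s0 * (norm (scl (c k) (z k - x k)) * norm (scl (c k) (y - x k)))"
      using s0 pos by (intro mult_mono Cauchy_Schwarz_ineq2) (auto intro: divide_left_mono)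
    also have "\<dots> \<le> 1 / s0 * (norm (scl (c k) (z k - x k)) * (sqrt (max 1 (c 0)) * norm (y - x k)))"
      using s0 1 by (intro mult_left_mono) auto
    finally show ?thesis by (simp add: mult_ac)
  qed
  have "(\<lambda>k. norm (scl (c (\<rho> k)) (z (\<rho> k) - x (\<rho> k))) * (?m * norm (y - x (\<rho> k))))
      \<longlonglongrightarrow> 0 * (?m * norm (y - q))"
    using LIMSEQ_subseq_LIMSEQ[OF scaled_residual_tendsto_0 assms(1)] xlim
    by (intro tendsto_intros) (auto simp: o_def)
  then have "(\<lambda>k. norm (scl (c (\<rho> k)) (z (\<rho> k) - x (\<rho> k))) * (?m * norm (y - x (\<rho> k)))) \<longlonglongrightarrow> 0"
    by (simp only: mult_zero_left)
  then have elim: "(\<lambda>k. e (\<rho> k)) \<longlonglongrightarrow> 0"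
    by (rule Lim_null_comparison[rotated]) (simp add: bound[simplified])
  have "isCont F q" using cont continuous_on_eq_continuous_at[OF open_UNIV] by blast
  then have "(\<lambda>k. F (x (\<rho> k)) + e (\<rho> k)) \<longlonglongrightarrow> F q + 0"
    using elim xlim by (intro tendsto_add isCont_tendsto_compose[of q F])
  moreover have "F (x k) + e k \<le> F y" for k
    unfolding e_def by (rule prox_subgradient[OF conv linear_scl pos(2) prox])
  ultimately have "F q + 0 \<le> F y" by (intro LIMSEQ_le_const2) auto
  then show "F q \<le> F y" by simp
qed

text \<open>The usual Fejer argument: the scaled distance to a cluster point \<open>q\<close>
  converges since \<open>q\<close> is a solution, and it tends to 0 along a subsequence, so its
  limit is 0.\<close>

lemma converges: "\<exists>q \<in> minimizers F. z \<longlonglongrightarrow> q"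
proof -
  have "compact (closure (range z))" using bounded_iterates by simp
  then obtain q \<rho> where \<rho>: "strict_mono \<rho>" "(z \<circ> \<rho>) \<longlonglongrightarrow> q"
    using closure_subset[of "range z"] unfolding compact_def by blast
  then have q: "q \<in> minimizers F" by (rule cluster_point_minimizer)
  let ?a = "\<lambda>k. norm (scl (c k) (z k - q))"
  obtain l where l: "?a \<longlonglongrightarrow> l" using convergent_norm[OF q] by (auto simp: convergent_def)
  have bound: "?a k \<le> sqrt (max 1 (c 0)) * norm (z k - q)" for k
  proof -
    have "?a k \<le> norm (scl (c 0) (z k - q))"
      using decseqD[OF c_decr, of 0 k] pos[of k] by (intro norm_scl_mono) auto
    also have "\<dots> \<le> sqrt (max 1 (c 0)) * norm (z k - q)"
      using pos[of 0] by (intro norm_scl_le) auto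
    finally show ?thesis .
  qed
  have "(\<lambda>k. sqrt (max 1 (c 0)) * norm (z (\<rho> k) - q)) \<longlonglongrightarrow> sqrt (max 1 (c 0)) * norm (q - q)"
    using \<rho>(2) by (intro tendsto_intros) (simp add: o_def)
  then have "(\<lambda>k. sqrt (max 1 (c 0)) * norm (z (\<rho> k) - q)) \<longlonglongrightarrow> 0" by simp
  then have "(\<lambda>k. ?a (\<rho> k)) \<longlonglongrightarrow> 0"
    by (rule Lim_null_comparison[rotated]) (simp add: bound)
  moreover have "(\<lambda>k. ?a (\<rho> k)) \<longlonglongrightarrow> l"
    using LIMSEQ_subseq_LIMSEQ[OF l \<rho>(1)] by (simp add: o_def)
  ultimately have "l = 0" using LIMSEQ_unique by blast
  have "(\<lambda>k. z k - q) \<longlonglongrightarrow> 0"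
  proof (rule Lim_null_comparison)
    have "norm (z k - q) \<le> ?a k / sqrt (min 1 c0)" for k
    proof -
      have "sqrt (min 1 c0) * norm (z k - q) \<le> norm (scl c0 (z k - q))"
        using c0 by (intro norm_le_scl) auto
      also have "\<dots> \<le> ?a k" using c0 by (intro norm_scl_mono) auto
      finally show ?thesis using c0 by (simp add: le_divide_eq mult.commute)
    qed
    then show "\<forall>\<^sub>F k in sequentially. norm (z k - q) \<le> ?a k / sqrt (min 1 c0)" by simp
    have "(\<lambda>k. ?a k / sqrt (min 1 c0)) \<longlonglongrightarrow> 0 / sqrt (min 1 c0)"
      using c0 l \<open>l = 0\<close> by (intro tendsto_divide tendsto_const) auto
    then show "(\<lambda>k. ?a k / sqrt (min 1 c0)) \<longlonglongrightarrow> 0" by simp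
  qed
  then show ?thesis using q LIM_zero_iff by blast
qed

text \<open>The exact point contracts by \<open>prox_rate\<close>. The error in criterion (B) is
  relative to the actual step, which must itself be bounded by the distance to the solution set
  before it can enter the rate.\<close>

lemma linear_step:
  assumes \<delta>: "0 \<le> \<delta>" "\<delta> < 1" and \<kappa>: "0 < \<kappa>"
    and B: "norm (scl (c k) (z (Suc k)) - scl (c k) (x k)) \<le> \<delta> * norm (scl (c k) (z (Suc k)) - scl (c k) (z k))"
    and err: "infdist (x k) (minimizers F) \<le> \<kappa> * infdist 0 (subdifferential F (x k))"
  shows "D (Suc k) (z (Suc k)) \<le> 1 / (1 - \<delta>) * (\<delta> + (1 + \<delta>) * \<kappa> * max 1 (c k)
    / sqrt ((s k)\<^sup>2 + \<kappa>\<^sup>2 * (max 1 (c k))\<^sup>2)) * D k (z k)"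
proof -
  define q where "q = \<kappa> * max 1 (c k) / sqrt ((s k)\<^sup>2 + \<kappa>\<^sup>2 * (max 1 (c k))\<^sup>2)"
  define N where "N = norm (scl (c k) (z (Suc k)) - scl (c k) (z k))"
  have D0: "0 \<le> D k (z k)" by (rule infdist_nonneg)
  have q0: "0 \<le> q" using \<kappa> by (simp add: q_def)
  have "(norm (scl (c k) (z k) - scl (c k) (x k)))\<^sup>2 \<le> (D k (z k))\<^sup>2"
    using prox_infdist_sq[OF conv pos(2) ne prox, of k]
      zero_le_power2[of "D k (x k)"] by linarith
  then have zx: "norm (scl (c k) (z k) - scl (c k) (x k)) \<le> D k (z k)"
    using D0 by (rule power2_le_imp_le)
  have "N \<le> norm (scl (c k) (z (Suc k)) - scl (c k) (x k)) + norm (scl (c k) (z k) - scl (c k) (x k))"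
    unfolding N_def by (metis dist_norm dist_triangle2)
  then have "N \<le> \<delta> * N + D k (z k)" using B zx by (simp add: N_def)
  \<comment> \<open>The step length occurs on both sides; solving for it produces the factor
    \<open>1 / (1 - \<delta>)\<close>.\<close>
  then have N: "N \<le> D k (z k) / (1 - \<delta>)" using \<delta> by (simp add: field_simps)
  have "D (Suc k) (z (Suc k)) \<le> D k (z (Suc k))"
    using infdist_scl_mono[OF less_imp_le[OF pos(1)] c_Suc] .
  also have "\<dots> \<le> D k (x k) + norm (scl (c k) (z (Suc k)) - scl (c k) (x k))"
    unfolding dist_norm[symmetric] by (rule infdist_triangle)
  also have "\<dots> \<le> q * D k (z k) + \<delta> * (D k (z k) / (1 - \<delta>))"
    using prox_rate[OF conv ne pos(2) pos(1) \<kappa> prox err] B mult_left_mono[OF N \<delta>(1)]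
    unfolding q_def N_def by linarith
  also have "\<dots> = 1 / (1 - \<delta>) * (\<delta> + (1 - \<delta>) * q) * D k (z k)"
    using \<delta> by (simp add: field_simps)
  \<comment> \<open>The argument yields the smaller coefficient \<open>1 - \<delta>\<close>; it is
    enlarged to reach the form of the claimed rate.\<close>
  also have "\<dots> \<le> 1 / (1 - \<delta>) * (\<delta> + (1 + \<delta>) * q) * D k (z k)"
    using \<delta> D0 q0 by (intro mult_left_mono mult_right_mono add_left_mono) auto
  finally show ?thesis by (simp add: q_def mult.assoc)
qed

end

section \<open>The error bound for the logistic objective\<close>

text \<open>The derivative of \<open>ln (1 + exp t)\<close>.\<close>

definition sigmoid :: "real \<Rightarrow> real" where
  "sigmoid t = exp t / (1 + exp t)"

text \<open>The constant bounds the second derivative \<open>exp r / (1 + exp r)^2\<close> below on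
  \<open>{-R..R}\<close>, with the numerator taken at \<open>- R\<close> and the denominator at
  \<open>R\<close>. Subtracting the matching parabola leaves a convex function, whose tangent
  inequality is the claim.\<close>

lemma softplus_strongly_convex:
  assumes "\<bar>s\<bar> \<le> R" "\<bar>t\<bar> \<le> R"
  shows "ln (1 + exp s) + sigmoid s * (t - s) + exp (- R) / (1 + exp R)\<^sup>2 / 2 * (t - s)\<^sup>2 \<le> ln (1 + exp t)"
proof -
  define c where "c = exp (- R) / (1 + exp R)\<^sup>2"
  have pos: "0 < 1 + exp r" for r :: real
    using exp_gt_zero[of r] by linarith
  have d1: "DERIV (\<lambda>r. ln (1 + exp r)) r :> sigmoid r" for r
    using pos[of r] by (auto intro!: derivative_eq_intros simp: sigmoid_def)
  have d2: "DERIV sigmoid r :> exp r / (1 + exp r)\<^sup>2" for r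
  proof -
    have "DERIV (\<lambda>r. exp r / (1 + exp r)) r
        :> (exp r * (1 + exp r) - exp r * (0 + exp r)) / ((1 + exp r) * (1 + exp r))"
      using pos[of r] by (intro DERIV_divide DERIV_add DERIV_const DERIV_exp) auto
    moreover have "exp r * (1 + exp r) - exp r * (0 + exp r) = exp r" by (simp add: algebra_simps)
    ultimately show ?thesis by (simp add: sigmoid_def[abs_def] power2_eq_square)
  qed
  have "(sigmoid s - c * s) * (t - s) \<le> (ln (1 + exp t) - c / 2 * t\<^sup>2) - (ln (1 + exp s) - c / 2 * s\<^sup>2)"
  proof (rule f''_imp_f'[where C = "{-R..R}" and f = "\<lambda>r. ln (1 + exp r) - c / 2 * r\<^sup>2"
        and f' = "\<lambda>r. sigmoid r - c * r" and f'' = "\<lambda>r. exp r / (1 + exp r)\<^sup>2 - c"])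
    show "DERIV (\<lambda>r. ln (1 + exp r) - c / 2 * r\<^sup>2) r :> sigmoid r - c * r" for r
      by (rule derivative_eq_intros d1 refl | simp)+
    show "DERIV (\<lambda>r. sigmoid r - c * r) r :> exp r / (1 + exp r)\<^sup>2 - c" for r
      by (rule derivative_eq_intros d2 refl | simp)+
    show "0 \<le> exp r / (1 + exp r)\<^sup>2 - c" if "r \<in> {-R..R}" for r
    proof -
      have "exp (- R) / (1 + exp R)\<^sup>2 \<le> exp r / (1 + exp r)\<^sup>2"
        using that pos[of r] by (intro frac_le power_mono) auto
      then show ?thesis by (simp add: c_def)
    qed
  qed (use assms in auto)
  then show ?thesis unfolding c_def[symmetric] by (simp add: algebra_simps power2_eq_square)
qed

text \<open>The gradient of \<open>logistic_loss b\<close>, given by its formula; it enters through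
  the tangent inequality and its own continuity.\<close>

definition logistic_grad :: "real^'m \<Rightarrow> real^'m \<Rightarrow> real^'m" where
  "logistic_grad b y = (\<chi> i. - (b $ i) / real CARD('m) * sigmoid (- b $ i * y $ i))"

text \<open>Labels of modulus 1 keep every argument within \<open>R\<close> and leave the squared
  differences unchanged, so the scalar estimates add up to the Euclidean norm.\<close>

lemma logistic_loss_strongly_convex:
  fixes b x y :: "real^'m"
  assumes b: "\<forall>i. b $ i \<in> {-1, 1}" and R: "norm x \<le> R" "norm y \<le> R"
  shows "logistic_loss b y + logistic_grad b y \<bullet> (x - y)
      + exp (- R) / (1 + exp R)\<^sup>2 / (2 * real CARD('m)) * (norm (x - y))\<^sup>2 \<le> logistic_loss b x"
proof -
  let ?m = "real CARD('m)" and ?c = "exp (- R) / (1 + exp R)\<^sup>2"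
  have m: "0 < ?m" by simp
  have bound: "\<bar>- b $ i * x $ i\<bar> \<le> R" "\<bar>- b $ i * y $ i\<bar> \<le> R" for i
    using b[rule_format, of i] component_le_norm_cart[of x i] component_le_norm_cart[of y i] R by auto
  have sq: "(- b $ i * x $ i - - b $ i * y $ i)\<^sup>2 = (x $ i - y $ i)\<^sup>2" for i
    using b[rule_format, of i] by (auto simp: power2_commute)
  have "1 / ?m * (\<Sum>i\<in>UNIV. ln (1 + exp (- b $ i * y $ i))
      + sigmoid (- b $ i * y $ i) * (- b $ i * x $ i - - b $ i * y $ i) + ?c / 2 * (x $ i - y $ i)\<^sup>2)
    \<le> 1 / ?m * (\<Sum>i\<in>UNIV. ln (1 + exp (- b $ i * x $ i)))"
  proof (intro mult_left_mono sum_mono)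
    fix i
    show "ln (1 + exp (- b $ i * y $ i)) + sigmoid (- b $ i * y $ i) * (- b $ i * x $ i - - b $ i * y $ i)
        + ?c / 2 * (x $ i - y $ i)\<^sup>2 \<le> ln (1 + exp (- b $ i * x $ i))"
      using softplus_strongly_convex[OF bound(2)[of i] bound(1)[of i]] unfolding sq .
  qed simp
  also have "(\<Sum>i\<in>UNIV. ln (1 + exp (- b $ i * y $ i))
      + sigmoid (- b $ i * y $ i) * (- b $ i * x $ i - - b $ i * y $ i) + ?c / 2 * (x $ i - y $ i)\<^sup>2)
    = (\<Sum>i\<in>UNIV. ln (1 + exp (- b $ i * y $ i))) + ?m * (logistic_grad b y \<bullet> (x - y))
      + ?c / 2 * (norm (x - y))\<^sup>2"
  proof -
    have "sigmoid (- b $ i * y $ i) * (- b $ i * x $ i - - b $ i * y $ i)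
        = ?m * (logistic_grad b y $ i * (x - y) $ i)" for i
      by (simp add: logistic_grad_def field_simps)
    moreover have "(norm (x - y))\<^sup>2 = (\<Sum>i\<in>UNIV. (x $ i - y $ i)\<^sup>2)"
      by (simp add: norm_vec_def L2_set_def sum_nonneg)
    ultimately show ?thesis
      by (simp only: sum.distrib sum_distrib_left[symmetric] inner_vec_def inner_real_def)
  qed
  finally show ?thesis using m
    by (simp add: logistic_loss_def distrib_left mult_ac)
qed

lemma logistic_loss_tangent:
  assumes "\<forall>i. b $ i \<in> {-1, 1}"
  shows "logistic_loss b y + logistic_grad b y \<bullet> (x - y) \<le> logistic_loss b x"
proof -
  let ?R = "max (norm x) (norm y)"
  have "logistic_loss b y + logistic_grad b y \<bullet> (x - y)
      + exp (- ?R) / (1 + exp ?R)\<^sup>2 / (2 * real CARD('a)) * (norm (x - y))\<^sup>2 \<le> logistic_loss b x"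
    by (rule logistic_loss_strongly_convex[OF assms]) auto
  moreover have "0 \<le> exp (- ?R) / (1 + exp ?R)\<^sup>2 / (2 * real CARD('a)) * (norm (x - y))\<^sup>2"
    by simp
  ultimately show ?thesis by linarith
qed

lemma continuous_logistic_loss: "continuous_on S (logistic_loss b)"
  unfolding logistic_loss_def
  by (intro continuous_intros) (metis add.commute exp_gt_zero add_pos_pos zero_less_one less_irrefl)

lemma logistic_loss_nonneg: "0 \<le> logistic_loss b x"
  unfolding logistic_loss_def by (intro mult_nonneg_nonneg sum_nonneg) auto

lemma tendsto_logistic_grad:
  assumes "(f \<longlongrightarrow> y) F" shows "((\<lambda>x. logistic_grad b (f x)) \<longlongrightarrow> logistic_grad b y) F"
proof -
  have "1 + exp r \<noteq> 0" for r :: real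
    using exp_gt_zero[of r] by linarith
  then show ?thesis
    unfolding logistic_grad_def sigmoid_def using assms by (intro tendsto_intros) auto
qed

section \<open>The prediction map and convexity of the objective\<close>

definition affine_pred :: "real^'n^'m \<Rightarrow> (real^'n) \<times> real \<Rightarrow> real^'m" where
  "affine_pred A z = A *v fst z + snd z *\<^sub>R 1"

definition adjoint_pred :: "real^'n^'m \<Rightarrow> real^'m \<Rightarrow> (real^'n) \<times> real" where
  "adjoint_pred A g = (transpose A *v g, g \<bullet> 1)"

lemma objective_eq: "objective A b lam z = logistic_loss b (affine_pred A z) + lam * l1_norm (fst z)"
  by (simp add: objective_def affine_pred_def split: prod.split)

lemma linear_affine_pred: "linear (affine_pred A)"
  by (rule linearI)
    (auto simp: affine_pred_def matrix_vector_right_distrib matrix_vector_mult_scaleR algebra_simps)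

lemma inner_affine_pred: "g \<bullet> affine_pred A z = adjoint_pred A g \<bullet> z"
  by (simp add: affine_pred_def adjoint_pred_def inner_prod_def inner_add_right
      transpose_matrix_vector dot_lmul_matrix)

text \<open>Exhibits the normals of the hyperplanes on which a single prediction is constant, as
  needed for a linear system over pairs.\<close>

lemma affine_pred_component: "affine_pred A z $ i = (A $ i, 1) \<bullet> z"
  by (simp add: affine_pred_def inner_prod_def matrix_vector_mul_component)

lemma continuous_affine_pred: "continuous_on S (affine_pred A)"
  using linear_continuous_on linear_affine_pred linear_conv_bounded_linear by blast

lemma continuous_objective: "continuous_on S (objective A b lam)"
proof -
  have "continuous_on S (\<lambda>z. logistic_loss b (affine_pred A z))"
    using continuous_on_compose2[OF continuous_logistic_loss continuous_affine_pred] by blast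
  then show ?thesis
    unfolding objective_eq l1_norm_def by (intro continuous_intros)
qed

lemma objective_nonneg: "0 < lam \<Longrightarrow> 0 \<le> objective A b lam z"
  unfolding objective_eq l1_norm_def
  by (intro add_nonneg_nonneg mult_nonneg_nonneg sum_nonneg logistic_loss_nonneg) auto

text \<open>The witness is the pulled-back gradient of the loss plus \<open>lam\<close> times the
  coordinatewise sign. The value \<open>sgn 0 = 0\<close> is admissible, since the subdifferential
  of the absolute value at 0 is \<open>[-1, 1]\<close>.\<close>

lemma objective_subdifferential_nonempty:
  fixes A :: "real^'n^'m"
  assumes b: "\<forall>i. b $ i \<in> {-1, 1}" and lam: "0 < lam"
  shows "T_f A b lam z \<noteq> {}"
proof -
  let ?g = "adjoint_pred A (logistic_grad b (affine_pred A z)) + lam *\<^sub>R (\<chi> i. sgn (fst z $ i), 0)"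
  have "objective A b lam z + ?g \<bullet> (y - z) \<le> objective A b lam y" for y
  proof -
    have "sgn s * (t - s) \<le> \<bar>t\<bar> - \<bar>s\<bar>" for s t :: real
      by (auto simp: sgn_if abs_if)
    then have "(\<chi> i. sgn (fst z $ i)) \<bullet> fst (y - z) \<le> l1_norm (fst y) - l1_norm (fst z)"
      unfolding l1_norm_def sum_subtractf[symmetric] inner_vec_def by (intro sum_mono) simp
    then have "lam * ((\<chi> i. sgn (fst z $ i)) \<bullet> fst (y - z)) \<le> lam * (l1_norm (fst y) - l1_norm (fst z))"
      using lam by (intro mult_left_mono) auto
    moreover have "logistic_loss b (affine_pred A z)
        + adjoint_pred A (logistic_grad b (affine_pred A z)) \<bullet> (y - z) \<le> logistic_loss b (affine_pred A y)"
      unfolding inner_affine_pred[symmetric] linear_diff[OF linear_affine_pred]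
      by (rule logistic_loss_tangent[OF b])
    ultimately show ?thesis
      unfolding objective_eq by (simp add: inner_add_left inner_prod_def right_diff_distrib)
  qed
  then show ?thesis unfolding T_f_def subdifferential_def by blast
qed

lemma convex_objective:
  assumes "\<forall>i. b $ i \<in> {-1, 1}" "0 < lam"
  shows "convex_on UNIV (objective A b lam)"
  using convex_on_if_subdifferential_nonempty objective_subdifferential_nonempty[OF assms]
  unfolding T_f_def by blast

section \<open>First-order optimality conditions\<close>

lemma l1_norm_convex_step:
  assumes "0 \<le> t" "t \<le> 1"
  shows "l1_norm (w + t *\<^sub>R (w' - w)) \<le> l1_norm w + t * (l1_norm w' - l1_norm w)"
proof -
  have "\<bar>r + t * (r' - r)\<bar> \<le> \<bar>r\<bar> + t * (\<bar>r'\<bar> - \<bar>r\<bar>)" for r r'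
  proof -
    have "\<bar>(1 - t) * r + t * r'\<bar> \<le> \<bar>(1 - t) * r\<bar> + \<bar>t * r'\<bar>" by (rule abs_triangle_ineq)
    also have "\<dots> = \<bar>r\<bar> + t * (\<bar>r'\<bar> - \<bar>r\<bar>)" using assms by (simp add: abs_mult) (simp add: algebra_simps)
    also have "(1 - t) * r + t * r' = r + t * (r' - r)" by (simp add: algebra_simps)
    finally show ?thesis .
  qed
  then have "l1_norm (w + t *\<^sub>R (w' - w)) \<le> (\<Sum>i\<in>UNIV. \<bar>w $ i\<bar> + t * (\<bar>w' $ i\<bar> - \<bar>w $ i\<bar>))"
    unfolding l1_norm_def by (intro sum_mono) simp
  also have "\<dots> = l1_norm w + t * (l1_norm w' - l1_norm w)"
    by (simp add: l1_norm_def sum.distrib sum_subtractf sum_distrib_left[symmetric])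
  finally show ?thesis .
qed

text \<open>The tangent inequality is used at points converging to \<open>z0\<close>, so continuity of the gradient
  replaces differentiation.\<close>

lemma first_order_optimality:
  fixes A :: "real^'n^'m"
  assumes b: "\<forall>i. b $ i \<in> {-1, 1}" and lam: "0 < lam" and z0: "z0 \<in> Omega A b lam"
  shows "0 \<le> adjoint_pred A (logistic_grad b (affine_pred A z0)) \<bullet> (z - z0)
    + lam * (l1_norm (fst z) - l1_norm (fst z0))"
proof -
  let ?P = "affine_pred A"
  define zt where "zt t = z0 + t *\<^sub>R (z - z0)" for t :: real
  define G where "G t = logistic_grad b (?P (zt t)) \<bullet> ?P (z - z0)" for t
  have "\<forall>\<^sub>F t in at_right 0. 0 \<le> G t + lam * (l1_norm (fst z) - l1_norm (fst z0))"
    unfolding eventually_at_right_field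
  proof (intro exI[of _ 1] conjI allI impI)
    fix t :: real assume t: "0 < t" "t < 1"
    have "?P z0 - ?P (zt t) = - (t *\<^sub>R ?P (z - z0))"
      by (simp add: zt_def linear_add[OF linear_affine_pred] linear_cmul[OF linear_affine_pred])
    then have "logistic_loss b (?P (zt t)) - t * G t \<le> logistic_loss b (?P z0)"
      using logistic_loss_tangent[OF b, of "?P (zt t)" "?P z0"] by (simp add: G_def)
    moreover have "objective A b lam z0 \<le> objective A b lam (zt t)"
      using z0 unfolding Omega_def minimizers_iff by blast
    moreover have "lam * l1_norm (fst (zt t)) \<le> lam * (l1_norm (fst z0) + t * (l1_norm (fst z) - l1_norm (fst z0)))"
      using l1_norm_convex_step[of t "fst z0" "fst z"] t lam by (intro mult_left_mono) (auto simp: zt_def)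
    ultimately have "0 \<le> t * (G t + lam * (l1_norm (fst z) - l1_norm (fst z0)))"
      unfolding objective_eq by (simp add: algebra_simps)
    then show "0 \<le> G t + lam * (l1_norm (fst z) - l1_norm (fst z0))"
      using t by (simp add: zero_le_mult_iff)
  qed auto
  moreover have "(G \<longlongrightarrow> logistic_grad b (?P (z0 + 0 *\<^sub>R (z - z0))) \<bullet> ?P (z - z0)) (at_right 0)"
    unfolding G_def zt_def
    by (intro tendsto_intros tendsto_logistic_grad
        bounded_linear.tendsto[OF linear_affine_pred[unfolded linear_conv_bounded_linear]])
  then have "((\<lambda>t. G t + lam * (l1_norm (fst z) - l1_norm (fst z0))) \<longlongrightarrow>
      logistic_grad b (?P z0) \<bullet> ?P (z - z0) + lam * (l1_norm (fst z) - l1_norm (fst z0))) (at_right 0)"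
    by (intro tendsto_intros) simp
  ultimately have "0 \<le> logistic_grad b (?P z0) \<bullet> ?P (z - z0) + lam * (l1_norm (fst z) - l1_norm (fst z0))"
    by (intro tendsto_lowerbound) auto
  then show ?thesis by (simp add: inner_affine_pred)
qed

text \<open>The linearised objective is positively homogeneous and minimal at \<open>z0\<close>, so
  comparison with \<open>0\<close> and \<open>2 z0\<close> makes its minimum 0. Testing it with unit
  vectors of both signs then gives the bounds on \<open>q\<close>.\<close>

lemma optimal_multiplier:
  fixes A :: "real^'n^'m"
  assumes "\<forall>i. b $ i \<in> {-1, 1}" "0 < lam" "z0 \<in> Omega A b lam"
  defines "q \<equiv> adjoint_pred A (logistic_grad b (affine_pred A z0))"
  shows "snd q = 0" and "\<bar>fst q $ j\<bar> \<le> lam"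
    and "fst q \<bullet> fst z0 + lam * l1_norm (fst z0) = 0"
proof -
  have opt: "fst q \<bullet> fst z0 + snd q * snd z0 + lam * l1_norm (fst z0)
      \<le> fst q \<bullet> fst z + snd q * snd z + lam * l1_norm (fst z)" for z
    using first_order_optimality[OF assms(1-3), of z]
    by (simp add: q_def[symmetric] inner_prod_def algebra_simps)
  have l1_0: "l1_norm (0 :: real^'n) = 0" by (simp add: l1_norm_def)
  have l1_2: "l1_norm (2 *\<^sub>R w) = 2 * l1_norm w" for w :: "real^'n"
    by (simp add: l1_norm_def abs_mult sum_distrib_left)
  have z: "fst q \<bullet> fst z0 + snd q * snd z0 + lam * l1_norm (fst z0) = 0"
    using opt[of 0] opt[of "2 *\<^sub>R z0"] by (simp add: l1_0 l1_2)
  show q0: "snd q = 0"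
    using opt[of "(0, 1)"] opt[of "(0, -1)"] z by (simp add: l1_0)
  show "fst q \<bullet> fst z0 + lam * l1_norm (fst z0) = 0" using z q0 by simp
  have l1_axis: "l1_norm (axis j s :: real^'n) = \<bar>s\<bar>" for s
    by (simp add: l1_norm_def axis_def if_distrib[of abs] cong: if_cong)
  show "\<bar>fst q $ j\<bar> \<le> lam"
    using opt[of "(axis j 1, 0)"] opt[of "(axis j (-1), 0)"] z
    by (simp add: l1_axis inner_axis abs_le_iff)
qed

text \<open>The solution \<open>z0\<close> is fixed, and the Hoffman system describes points with
  its predictions and with vanishing \<open>\<phi>\<close> terms. These points are solutions, so the
  distance to them bounds the distance to the whole solution set.\<close>

lemma quadratic_growth:
  fixes A :: "real^'n^'m"
  assumes b: "\<forall>i. b $ i \<in> {-1, 1}" and lam: "0 < lam" and z0: "z0 \<in> Omega A b lam"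
    and S: "compact S"
  obtains K where "K > 0"
    "\<And>z. z \<in> S \<Longrightarrow> (infdist z (Omega A b lam))\<^sup>2 \<le> K * (objective A b lam z - objective A b lam z0)"
proof -
  let ?f = "objective A b lam" and ?P = "affine_pred A" and ?m = "real CARD('m)"
  define y0 where "y0 = ?P z0"
  define q where "q = adjoint_pred A (logistic_grad b y0)"
  note mult = optimal_multiplier[OF b lam z0, folded y0_def, folded q_def]
  \<comment> \<open>The contribution of one coordinate to the linearised objective; it is
    nonnegative because \<open>q\<close> has entries of modulus at most \<open>lam\<close>.\<close>
  define \<phi> where "\<phi> j t = fst q $ j * t + lam * \<bar>t\<bar>" for j t
  have \<phi>_sum: "(\<Sum>j\<in>UNIV. \<phi> j (w $ j)) = fst q \<bullet> w + lam * l1_norm w" for w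
    by (simp add: \<phi>_def sum.distrib inner_vec_def l1_norm_def sum_distrib_left)
  have \<phi>_ge: "(fst q $ j + (if p then lam else - lam)) * t \<le> \<phi> j t" for j p t
    using lam mult_left_mono[OF abs_ge_self[of t], of lam] mult_left_mono[OF abs_ge_minus_self[of t], of lam]
    by (simp add: \<phi>_def distrib_right)
  have \<phi>0: "0 \<le> \<phi> j t" for j t
  proof -
    have "\<bar>fst q $ j * t\<bar> \<le> lam * \<bar>t\<bar>" unfolding abs_mult by (intro mult_right_mono mult(2)) auto
    then show ?thesis by (simp add: \<phi>_def abs_le_iff)
  qed
  have grad: "logistic_grad b y0 \<bullet> (?P z - y0) = fst q \<bullet> fst z - fst q \<bullet> fst z0" for z
    unfolding y0_def linear_diff[OF linear_affine_pred, symmetric] inner_affine_pred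
    using mult(1) by (simp add: q_def[unfolded y0_def, symmetric] inner_prod_def inner_diff_right)

  \<comment> \<open>\<open>fst q $ j * t + lam * \<bar>t\<bar>\<close> is the maximum of two linear functions of \<open>t\<close>, so its sublevel set at
    \<open>0\<close> is given by two linear constraints, indexed by \<open>bool\<close> like the two signs of an equation.\<close>
  define a :: "('m \<times> bool) + ('n \<times> bool) \<Rightarrow> (real^'n) \<times> real" where
    "a k = (case k of Inl (i, p) \<Rightarrow> (if p then 1 else -1) *\<^sub>R (A $ i, 1)
      | Inr (j, p) \<Rightarrow> (axis j (fst q $ j + (if p then lam else - lam)), 0))" for k
  define \<beta> :: "('m \<times> bool) + ('n \<times> bool) \<Rightarrow> real" where
    "\<beta> k = (case k of Inl (i, p) \<Rightarrow> (if p then 1 else -1) * y0 $ i | Inr _ \<Rightarrow> 0)" for k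
  have aL: "a (Inl (i, p)) \<bullet> z - \<beta> (Inl (i, p)) = (if p then 1 else -1) * (?P z - y0) $ i" for i p z
    by (simp add: a_def \<beta>_def affine_pred_component inner_prod_def algebra_simps)
  have aR: "a (Inr (j, p)) \<bullet> z - \<beta> (Inr (j, p)) = (fst q $ j + (if p then lam else - lam)) * fst z $ j" for j p z
    by (simp add: a_def \<beta>_def inner_prod_def inner_axis' )
  define Q where "Q = {z. \<forall>k\<in>UNIV. a k \<bullet> z \<le> \<beta> k}"
  have inQ: "z \<in> Q \<longleftrightarrow> (\<forall>k. a k \<bullet> z - \<beta> k \<le> 0)" for z by (simp add: Q_def)
  have "z0 \<in> Q"
    unfolding inQ
  proof
    fix k
    \<comment> \<open>Complementarity: nonnegative terms with sum 0 vanish one by one.\<close>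
    have "\<phi> j (fst z0 $ j) = 0" for j
      using mult(3) \<phi>0 unfolding \<phi>_sum[symmetric] by (subst (asm) sum_nonneg_eq_0_iff) auto
    then have "(fst q $ j + (if p then lam else - lam)) * fst z0 $ j \<le> 0" for j p
      using \<phi>_ge by metis
    then show "a k \<bullet> z0 - \<beta> k \<le> 0"
      by (cases k) (auto simp only: aL aR y0_def diff_self zero_index mult_zero_right order_refl)
  qed
  have "Q \<subseteq> Omega A b lam"
  proof
    fix z assume z: "z \<in> Q"
    have "(?P z - y0) $ i = 0" for i
      using z[unfolded inQ, rule_format, of "Inl (i, True)"] z[unfolded inQ, rule_format, of "Inl (i, False)"]
      unfolding aL by simp
    then have y: "?P z = y0" by (simp add: vec_eq_iff)
    \<comment> \<open>The sign of the coordinate selects which of the two linear pieces equals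
      \<open>\<phi>\<close>.\<close>
    have "\<phi> j (fst z $ j) \<le> 0" for j
      using z[unfolded inQ, rule_format, of "Inr (j, True)"] z[unfolded inQ, rule_format, of "Inr (j, False)"]
      unfolding aR by (cases "0 \<le> fst z $ j") (auto simp: \<phi>_def algebra_simps)
    then have "fst q \<bullet> fst z + lam * l1_norm (fst z) \<le> 0"
      unfolding \<phi>_sum[symmetric] by (intro sum_nonpos)
    then have "?f z \<le> ?f z0"
      using grad[of z] mult(3) y unfolding objective_eq by (simp add: y0_def)
    then show "z \<in> Omega A b lam"
      using z0 unfolding Omega_def minimizers_iff by (meson order_trans)
  qed

  obtain C where C: "C > 0" "\<And>z. infdist z Q \<le> C * (\<Sum>k\<in>UNIV. max 0 (a k \<bullet> z - \<beta> k))"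
    using hoffman_bound[OF finite_class.finite_UNIV Q_def] \<open>z0 \<in> Q\<close> by blast

  have "bounded (?P ` S)" "bounded (?f ` S)"
    using compact_continuous_image[OF continuous_affine_pred S] compact_continuous_image[OF continuous_objective S]
      compact_imp_bounded by blast+
  then obtain R1 G where R1: "\<And>z. z \<in> S \<Longrightarrow> norm (?P z) \<le> R1" and G: "\<And>z. z \<in> S \<Longrightarrow> \<bar>?f z\<bar> \<le> G"
    unfolding bounded_iff by (metis imageI real_norm_def)
  define R where "R = max R1 (norm y0)"
  define c where "c = exp (- R) / (1 + exp R)\<^sup>2 / (2 * ?m)"
  have c: "0 < c" unfolding c_def by (intro divide_pos_pos mult_pos_pos zero_less_power add_pos_pos) auto
  \<comment> \<open>The two kinds of constraints violate at different orders. Squared prediction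
    residuals are bounded by \<open>1 / c\<close> times the gap. The residuals from
    \<open>\<phi>\<close> are bounded by the gap itself, whose square is linear in the gap once the
    gap is bounded on \<open>S\<close>.\<close>
  define K where "K = max (1 / c) (\<bar>G\<bar> + \<bar>?f z0\<bar>)"
  have K: "0 < K" "1 / c \<le> K" using c by (auto simp: K_def less_max_iff_disj)
  define N where "N = real (card (UNIV :: (('m \<times> bool) + ('n \<times> bool)) set))"

  have main: "(infdist z (Omega A b lam))\<^sup>2 \<le> (C * N)\<^sup>2 * K * (?f z - ?f z0)" if z: "z \<in> S" for z
  proof -
    let ?gap = "?f z - ?f z0"
    have "norm (?P z) \<le> R" "norm y0 \<le> R" using R1[OF z] by (auto simp: R_def)
    then have "logistic_loss b y0 + logistic_grad b y0 \<bullet> (?P z - y0) + c * (norm (?P z - y0))\<^sup>2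
        \<le> logistic_loss b (?P z)"
      unfolding c_def by (rule logistic_loss_strongly_convex[OF b])
    \<comment> \<open>The linear term of the Bregman distance joins the l1 term, and their value at
      \<open>z0\<close> cancels by the multiplier relation.\<close>
    then have lb: "c * (norm (?P z - y0))\<^sup>2 + (\<Sum>j\<in>UNIV. \<phi> j (fst z $ j)) \<le> ?gap"
      using grad[of z] mult(3) unfolding objective_eq \<phi>_sum y0_def[symmetric] by linarith
    have \<phi>S: "0 \<le> (\<Sum>j\<in>UNIV. \<phi> j (fst z $ j))" by (intro sum_nonneg \<phi>0)
    have nn: "0 \<le> c * (norm (?P z - y0))\<^sup>2" using c by simp
    have gap0: "0 \<le> ?gap" using lb \<phi>S nn by linarith
    have gapK: "?gap \<le> K" using G[OF z] by (auto simp: K_def)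
    have "(max 0 (a k \<bullet> z - \<beta> k))\<^sup>2 \<le> K * ?gap" for k
    proof (cases k)
      case (Inl ip)
      obtain i p where ip: "ip = (i, p)" by fastforce
      have "max 0 (a k \<bullet> z - \<beta> k) \<le> norm (?P z - y0)"
        using component_le_norm_cart[of "?P z - y0" i] unfolding Inl ip aL by (auto simp: abs_le_iff)
      then have "(max 0 (a k \<bullet> z - \<beta> k))\<^sup>2 \<le> (norm (?P z - y0))\<^sup>2" by (intro power_mono) auto
      also have "\<dots> \<le> 1 / c * ?gap" using lb \<phi>S c by (simp add: field_simps)
      also have "\<dots> \<le> K * ?gap" using K gap0 by (intro mult_right_mono)
      finally show ?thesis .
    next
      case (Inr jp)
      obtain j p where jp: "jp = (j, p)" by fastforce
      have "\<phi> j (fst z $ j) \<le> (\<Sum>j\<in>UNIV. \<phi> j (fst z $ j))" using \<phi>0 by (intro member_le_sum) auto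
      then have "max 0 (a k \<bullet> z - \<beta> k) \<le> ?gap"
        using \<phi>_ge[of j p "fst z $ j"] lb nn gap0 unfolding Inr jp aR by simp
      then have "(max 0 (a k \<bullet> z - \<beta> k))\<^sup>2 \<le> ?gap\<^sup>2" by (intro power_mono) auto
      also have "\<dots> \<le> K * ?gap" using gapK gap0 by (auto simp: power2_eq_square intro: mult_right_mono)
      finally show ?thesis .
    qed
    then have "max 0 (a k \<bullet> z - \<beta> k) \<le> sqrt (K * ?gap)" for k
      by (intro real_le_rsqrt)
    then have "(\<Sum>k\<in>UNIV. max 0 (a k \<bullet> z - \<beta> k)) \<le> N * sqrt (K * ?gap)"
      unfolding N_def by (intro sum_bounded_above)
    then have "infdist z Q \<le> C * (N * sqrt (K * ?gap))"
      using C mult_left_mono[of _ _ C] by (meson less_imp_le order_trans)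
    moreover have "infdist z (Omega A b lam) \<le> infdist z Q"
      using \<open>Q \<subseteq> Omega A b lam\<close> \<open>z0 \<in> Q\<close> by (intro infdist_mono) auto
    ultimately have "infdist z (Omega A b lam) \<le> C * (N * sqrt (K * ?gap))" by simp
    then have "(infdist z (Omega A b lam))\<^sup>2 \<le> (C * (N * sqrt (K * ?gap)))\<^sup>2"
      by (intro power_mono infdist_nonneg)
    also have "\<dots> = (C * N)\<^sup>2 * K * ?gap" using K gap0 by (simp add: power_mult_distrib)
    finally show ?thesis .
  qed
  have "0 < N" unfolding N_def of_nat_0_less_iff card_gt_0_iff by simp
  show ?thesis
    by (rule that[of "(C * N)\<^sup>2 * K"]) (use C K \<open>0 < N\<close> main in auto)
qed

text \<open>For any subgradient \<open>g\<close> at \<open>z\<close>, its inequality at the nearest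
  solution bounds the gap by \<open>norm g\<close> times the distance; growth bounds the squared
  distance by \<open>K\<close> times the gap. Since \<open>K\<close> is independent of
  \<open>g\<close>, the infimum over \<open>g\<close> follows.\<close>

lemma error_bound:
  fixes A :: "real^'n^'m"
  assumes b: "\<forall>i. b $ i \<in> {-1, 1}" and lam: "0 < lam"
    and ne: "Omega A b lam \<noteq> {}" and cpt: "compact (Omega A b lam)"
  obtains \<kappa> where "\<kappa> > 0"
    "\<And>z. infdist z (Omega A b lam) \<le> R \<Longrightarrow> infdist z (Omega A b lam) \<le> \<kappa> * infdist 0 (T_f A b lam z)"
proof -
  let ?W = "Omega A b lam" and ?f = "objective A b lam"
  obtain z0 where z0: "z0 \<in> ?W" using ne by blast
  \<comment> \<open>\<open>R\<close> is arbitrary, so the maximum with 1 ensures a positive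
    radius.\<close>
  have "compact {z. infdist z ?W \<le> max R 1}"
    using cpt ne by (intro compact_infdist_le) auto
  then obtain K where K: "K > 0" "\<And>z. infdist z ?W \<le> max R 1 \<Longrightarrow> (infdist z ?W)\<^sup>2 \<le> K * (?f z - ?f z0)"
    using quadratic_growth[OF b lam z0] by (metis (mono_tags, lifting) mem_Collect_eq)
  have "infdist z ?W \<le> K * infdist 0 (T_f A b lam z)" if z: "infdist z ?W \<le> R" for z
  proof -
    obtain p where p: "p \<in> ?W" "infdist z ?W = dist z p"
      using infdist_attains_inf[OF compact_imp_closed[OF cpt] ne] by blast
    have "?f p \<le> ?f z0" using p(1) unfolding Omega_def minimizers_iff by blast
    have "infdist z ?W / K \<le> infdist 0 (T_f A b lam z)"
    proof (rule infdist_greatest[OF objective_subdifferential_nonempty[OF b lam]])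
      fix g assume "g \<in> T_f A b lam z"
      then have "?f z + g \<bullet> (p - z) \<le> ?f p" unfolding T_f_def subdifferential_def by blast
      moreover have "- (g \<bullet> (p - z)) \<le> norm g * norm (p - z)"
        using Cauchy_Schwarz_ineq2[of g "p - z"] by linarith
      ultimately have "?f z - ?f z0 \<le> norm g * infdist z ?W"
        using \<open>?f p \<le> ?f z0\<close> by (simp add: p(2) dist_norm norm_minus_commute)
      then have "K * (?f z - ?f z0) \<le> K * (norm g * infdist z ?W)"
        using K by (intro mult_left_mono) auto
      then have "(infdist z ?W)\<^sup>2 \<le> K * (norm g * infdist z ?W)"
        using K(2)[of z] z by linarith
      then have "infdist z ?W * infdist z ?W \<le> (K * norm g) * infdist z ?W"
        by (simp add: power2_eq_square)
      then have "infdist z ?W \<le> K * norm g"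
        using infdist_nonneg[of z ?W] K(1) by (cases "infdist z ?W = 0") (auto simp: mult_le_cancel_right)
      then show "infdist z ?W / K \<le> dist 0 g" using K(1) by (simp add: field_simps)
    qed
    then show ?thesis using K(1) by (simp add: field_simps)
  qed
  then show ?thesis using that K(1) by blast
qed

section \<open>The stacked metric and the main theorem\<close>

lemma sum_UNIV_plus_1: "(\<Sum>i\<in>(UNIV :: ('n::finite + 1) set). F i) = (\<Sum>j\<in>UNIV. F (Inl j)) + F (Inr 1)"
proof -
  have "(UNIV :: 1 set) = {1}" by (auto intro: num1_eq1)
  then show ?thesis
    unfolding UNIV_Plus_UNIV[symmetric] by (simp add: sum.Plus)
qed

lemma precond_mult_component:
  "((precond s g :: real^('n::finite + 1)^('n + 1)) *v x) $ i = (case i of Inl _ \<Rightarrow> 1 | Inr _ \<Rightarrow> s / g) * x $ i"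
  by (simp add: precond_def matrix_vector_mult_def if_distrib[of "\<lambda>t. t * _"] cong: if_cong)

lemma quadratic_form_precond:
  "stack z \<bullet> (precond s g *v stack z) = (norm (fst z))\<^sup>2 + s / g * (snd z)\<^sup>2"
proof -
  have "stack z \<bullet> (precond s g *v stack z) = (\<Sum>j\<in>UNIV. fst z $ j * fst z $ j) + snd z * (s / g * snd z)"
    by (simp add: inner_vec_def precond_mult_component sum_UNIV_plus_1 stack_def)
  also have "(\<Sum>j\<in>UNIV. fst z $ j * fst z $ j) = (norm (fst z))\<^sup>2"
    by (simp add: power2_norm_eq_inner inner_vec_def)
  finally show ?thesis by (simp add: power2_eq_square)
qed

lemma stack_diff: "stack x - stack y = stack (x - y)"
  by (simp add: stack_def vec_eq_iff split: sum.split)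

lemma mnorm_precond: "0 \<le> s / g \<Longrightarrow> mnorm (precond s g) (stack x - stack y) = norm (scl (s / g) x - scl (s / g) y)"
  unfolding mnorm_def stack_diff quadratic_form_precond linear_diff[OF linear_scl, symmetric]
  by (simp only: norm_scl_sq[symmetric] real_sqrt_abs abs_norm_cancel)

lemma dist_M_precond:
  assumes "0 \<le> s / g" "S \<noteq> {}"
  shows "dist_M (precond s g) (stack z) (stack ` S) = infdist (scl (s / g) z) (scl (s / g) ` S)"
  using assms by (simp add: dist_M_def infdist_notempty image_image mnorm_precond dist_norm)

lemma eigenvalues_precond: "eigenvalues (precond s g :: real^('n::finite + 1)^('n + 1)) = {1, s / g}"
proof (intro equalityI subsetI)
  fix l assume "l \<in> eigenvalues (precond s g :: real^('n + 1)^('n + 1))"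
  then obtain x :: "real^('n + 1)" where x: "x \<noteq> 0" "precond s g *v x = l *\<^sub>R x"
    by (auto simp: eigenvalues_def)
  then obtain i where "x $ i \<noteq> 0" by (auto simp: vec_eq_iff)
  moreover have "(case i of Inl _ \<Rightarrow> 1 | Inr _ \<Rightarrow> s / g) * x $ i = l * x $ i"
    using arg_cong[OF x(2), of "\<lambda>y. y $ i"]
    by (simp only: precond_mult_component vector_scaleR_component real_scaleR_def)
  ultimately have "l = (case i of Inl _ \<Rightarrow> 1 | Inr _ \<Rightarrow> s / g)" by (metis mult_right_cancel)
  then show "l \<in> {1, s / g}" by (cases i) auto
next
  have ev: "(case i of Inl _ \<Rightarrow> 1 | Inr _ \<Rightarrow> s / g) \<in> eigenvalues (precond s g :: real^('n + 1)^('n + 1))"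
    for i :: "'n + 1"
    unfolding eigenvalues_def
    by (intro CollectI exI[of _ "axis i 1"]) (auto simp: vec_eq_iff precond_mult_component axis_def)
  fix l assume "l \<in> {1, s / g}"
  then show "l \<in> eigenvalues (precond s g :: real^('n + 1)^('n + 1))"
    \<comment> \<open>Any index of the first block serves, as the type is nonempty.\<close>
    using ev[of "Inl undefined"] ev[of "Inr 1"] by auto
qed

lemma lambda_max_precond: "lambda_max (precond s g :: real^('n::finite + 1)^('n + 1)) = max 1 (s / g)"
  by (simp add: lambda_max_def eigenvalues_precond)

lemma lambda_min_precond: "lambda_min (precond s g :: real^('n::finite + 1)^('n + 1)) = min 1 (s / g)"
  by (simp add: lambda_min_def eigenvalues_precond)

text \<open>Testing the difference with the last unit vector isolates the only varying diagonal
  entry.\<close>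

lemma precond_loewner_le_imp:
  assumes "(precond s g :: real^('n::finite + 1)^('n + 1)) \<preceq> precond s' g'"
  shows "s / g \<le> s' / g'"
proof -
  let ?z = "(0, 1) :: (real^'n) \<times> real"
  have "0 \<le> stack ?z \<bullet> ((precond s' g' - precond s g) *v stack ?z)"
    using assms unfolding loewner_le_def psd_def by blast
  then show ?thesis
    unfolding matrix_vector_mult_diff_rdistrib inner_diff_right quadratic_form_precond by simp
qed

text \<open>Unique existence gives the definite description in \<open>prox_point\<close> its
  intended meaning.\<close>

lemma prox_point_in_minimizers:
  fixes A :: "real^'n^'m"
  assumes b: "\<forall>i. b $ i \<in> {-1, 1}" and lam: "0 < lam" and "0 < s" "0 < g"
  shows "prox_point A b lam s g z
    \<in> minimizers (\<lambda>y. objective A b lam y + 1 / (2 * s) * (norm (scl (s / g) y - scl (s / g) z))\<^sup>2)"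
proof -
  have "0 < s / g" using assms by simp
  then have "\<exists>!x. x \<in> minimizers (\<lambda>y. objective A b lam y + 1 / (2 * s) * (norm (scl (s / g) y - scl (s / g) z))\<^sup>2)"
    using assms
    by (intro ex1_prox convex_objective continuous_objective objective_nonneg linear_scl inj_scl)
  from theI'[OF this] show ?thesis
    using \<open>0 < s / g\<close> by (simp add: prox_point_def mnorm_precond)
qed

text \<open>As \<open>\<delta>\<close> vanishes, only the quotient \<open>q\<close> decides the
  limit. If \<open>\<sigma>\<close> is unbounded, it is dominated by
  \<open>l k / \<sigma> k\<close>; otherwise the positive limit of \<open>\<sigma>\<close> makes the
  inequality strict.\<close>

lemma rate_tendsto:
  assumes l: "l \<longlonglongrightarrow> linf" "0 < linf" "\<And>k. 0 \<le> l k" and \<delta>: "\<delta> \<longlonglongrightarrow> 0" and \<kappa>: "0 < \<kappa>"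
    and \<sigma>: "\<And>k. 0 < \<sigma> k" "incseq \<sigma>" "(\<lambda>k. ereal (\<sigma> k)) \<longlonglongrightarrow> \<sigma>inf"
  shows "(\<lambda>k. 1 / (1 - \<delta> k) * (\<delta> k + (1 + \<delta> k) * \<kappa> * l k / sqrt ((\<sigma> k)\<^sup>2 + \<kappa>\<^sup>2 * (l k)\<^sup>2)))
      \<longlonglongrightarrow> rate_inf linf \<sigma>inf \<kappa>"
    and "rate_inf linf \<sigma>inf \<kappa> < 1"
proof -
  define q where "q k = l k / sqrt ((\<sigma> k)\<^sup>2 + \<kappa>\<^sup>2 * (l k)\<^sup>2)" for k
  have red: "(\<lambda>k. 1 / (1 - \<delta> k) * (\<delta> k + (1 + \<delta> k) * \<kappa> * l k / sqrt ((\<sigma> k)\<^sup>2 + \<kappa>\<^sup>2 * (l k)\<^sup>2)))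
      \<longlonglongrightarrow> \<kappa> * Q" if "q \<longlonglongrightarrow> Q" for Q
  proof -
    have "(\<lambda>k. 1 / (1 - \<delta> k) * (\<delta> k + (1 + \<delta> k) * \<kappa> * q k)) \<longlonglongrightarrow> 1 / (1 - 0) * (0 + (1 + 0) * \<kappa> * Q)"
      using that \<delta> by (intro tendsto_intros) auto
    then show ?thesis by (simp add: q_def)
  qed
  have "(\<lambda>k. 1 / (1 - \<delta> k) * (\<delta> k + (1 + \<delta> k) * \<kappa> * l k / sqrt ((\<sigma> k)\<^sup>2 + \<kappa>\<^sup>2 * (l k)\<^sup>2)))
      \<longlonglongrightarrow> rate_inf linf \<sigma>inf \<kappa> \<and> rate_inf linf \<sigma>inf \<kappa> < 1"
  proof (cases \<sigma>inf)
    case (real s)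
    then have s: "\<sigma> \<longlonglongrightarrow> s" using \<sigma>(3) by simp
    \<comment> \<open>Monotonicity keeps the limit above \<open>\<sigma> 0\<close>.\<close>
    have "0 < s" using incseq_le[OF \<sigma>(2) s, of 0] \<sigma>(1)[of 0] by linarith
    then have pos: "0 < s\<^sup>2 + \<kappa>\<^sup>2 * linf\<^sup>2" by (simp add: add_pos_nonneg)
    have "q \<longlonglongrightarrow> linf / sqrt (s\<^sup>2 + \<kappa>\<^sup>2 * linf\<^sup>2)"
      unfolding q_def using l(1) s pos by (intro tendsto_intros) auto
    moreover have "\<kappa> * linf < sqrt (s\<^sup>2 + \<kappa>\<^sup>2 * linf\<^sup>2)"
      using \<open>0 < s\<close> by (intro real_less_rsqrt) (simp add: power_mult_distrib)
    ultimately show ?thesis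
      using red[of "linf / sqrt (s\<^sup>2 + \<kappa>\<^sup>2 * linf\<^sup>2)"] pos real by (simp add: rate_inf_def)
  next
    case PInf
    have "q \<longlonglongrightarrow> 0"
    proof (rule tendsto_sandwich[of "\<lambda>_. 0" q sequentially "\<lambda>k. l k * inverse (\<sigma> k)"])
      have "q k \<le> l k * inverse (\<sigma> k)" for k
      proof -
        have "\<sigma> k \<le> sqrt ((\<sigma> k)\<^sup>2 + \<kappa>\<^sup>2 * (l k)\<^sup>2)" by (rule real_le_rsqrt) simp
        then have "l k / sqrt ((\<sigma> k)\<^sup>2 + \<kappa>\<^sup>2 * (l k)\<^sup>2) \<le> l k / \<sigma> k"
          using \<sigma>(1)[of k] l(3)[of k] by (intro divide_left_mono mult_pos_pos) linarith+
        then show ?thesis by (simp add: q_def divide_inverse)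
      qed
      then show "\<forall>\<^sub>F k in sequentially. q k \<le> l k * inverse (\<sigma> k)" by simp
      have "filterlim \<sigma> at_top sequentially" using \<sigma>(3) PInf by (simp add: tendsto_PInfty_eq_at_top)
      then have "(\<lambda>k. inverse (\<sigma> k)) \<longlonglongrightarrow> 0" by (rule tendsto_inverse_0_at_top)
      from tendsto_mult[OF l(1) this] show "(\<lambda>k. l k * inverse (\<sigma> k)) \<longlonglongrightarrow> 0" by simp
    qed (use l in \<open>auto simp: q_def\<close>)
    then show ?thesis using red[of 0] PInf by (simp add: rate_inf_def)
  next
    case MInf
    \<comment> \<open>Positive step sizes cannot tend to minus infinity.\<close>
    have "0 \<le> \<sigma>inf"
      by (rule LIMSEQ_le_const[OF \<sigma>(3)]) (use \<sigma>(1) in \<open>auto intro: less_imp_le\<close>)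
    then show ?thesis using MInf by simp
  qed
  then show "(\<lambda>k. 1 / (1 - \<delta> k) * (\<delta> k + (1 + \<delta> k) * \<kappa> * l k / sqrt ((\<sigma> k)\<^sup>2 + \<kappa>\<^sup>2 * (l k)\<^sup>2)))
      \<longlonglongrightarrow> rate_inf linf \<sigma>inf \<kappa>" "rate_inf linf \<sigma>inf \<kappa> < 1"
    by blast+
qed

theorem theorem3:
  fixes A :: "real^'n^'m" and b :: "real^'m" and lam :: real
    and \<sigma> \<gamma> \<epsilon> :: "nat \<Rightarrow> real" and \<sigma>inf \<gamma>inf :: ereal
    and w0 :: "real^'n" and v0 :: real
  assumes "\<forall>i. b $ i \<in> {-1, 1}"
    and "0 < lam"
    and "Omega A b lam \<noteq> {}"
    and "compact (Omega A b lam)"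
    and "ppdna_params \<sigma> \<gamma> \<sigma>inf \<gamma>inf"
    and "param_assumption TYPE('n) \<sigma> \<gamma> \<sigma>inf \<gamma>inf"
    and "\<forall>k. 0 \<le> \<epsilon> k"
    and "summable \<epsilon>"
  shows "let \<Omega> = Omega A b lam;
             M = (\<lambda>k. precond (\<sigma> k) (\<gamma> k) :: real^('n + 1)^('n + 1));
             D = (\<lambda>k z. dist_M (M k) (stack z) (stack ` \<Omega>));
             r = (\<Sum>k. \<epsilon> k) + D 0 (w0, v0)
    in
    (\<forall>u w v. ppdna A b lam \<sigma> \<gamma> w0 v0 u w v \<and> criterion_A A b lam \<sigma> \<gamma> \<epsilon> w v \<longrightarrow>
        bounded (range (\<lambda>k. (w k, v k))) \<and>
        (\<forall>k. D (Suc k) (w (Suc k), v (Suc k)) \<le> D k (w k, v k) + \<epsilon> k) \<and>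
        (\<exists>ws vs. (\<lambda>k. (w k, v k)) \<longlonglongrightarrow> (ws, vs) \<and> (ws, vs) \<in> \<Omega> \<and> 0 \<in> T_f A b lam (ws, vs)))
    \<and>
    (\<exists>\<kappa>>0.
      (\<forall>w v. infdist (w, v) \<Omega> \<le> r \<longrightarrow> infdist (w, v) \<Omega> \<le> \<kappa> * infdist 0 (T_f A b lam (w, v))) \<and>
      (\<forall>\<delta> u w v.
        ppdna A b lam \<sigma> \<gamma> w0 v0 u w v \<and> criterion_A A b lam \<sigma> \<gamma> \<epsilon> w v \<and>
        criterion_B A b lam \<sigma> \<gamma> \<delta> w v \<and> incseq \<sigma> \<longrightarrow>
          (let \<mu> = (\<lambda>k. rate (M k) (\<sigma> k) (\<delta> k) \<kappa>);
               linf = real_of_ereal (limsup (\<lambda>k. ereal (lambda_max (M k))));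
               \<mu>inf = rate_inf linf \<sigma>inf \<kappa>
           in (\<forall>k. D (Suc k) (w (Suc k), v (Suc k)) \<le> \<mu> k * D k (w k, v k)) \<and>
              limsup (\<lambda>k. ereal (\<mu> k)) = ereal \<mu>inf \<and> \<mu>inf < 1 \<and>
              (\<forall>k. infdist (w (Suc k), v (Suc k)) \<Omega>
                    \<le> \<mu> k / sqrt (lambda_min (M (Suc k))) * D k (w k, v k)))))"
proof -
  note b = assms(1) and lam = assms(2) and ne = assms(3) and cpt = assms(4)
  let ?F = "objective A b lam"
  let ?\<Omega> = "minimizers ?F"
  define c where "c k = \<sigma> k / \<gamma> k" for k
  define D where "D k z = infdist (scl (c k) z) (scl (c k) ` ?\<Omega>)" for k z
  define r where "r = suminf \<epsilon> + D 0 (w0, v0)"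
  have \<sigma>\<gamma>: "0 < \<sigma> k" "0 < \<gamma> k" for k
    using assms(5) by (auto simp: ppdna_params_def)
  have \<sigma>inf: "(\<lambda>k. ereal (\<sigma> k)) \<longlonglongrightarrow> \<sigma>inf" using assms(5) by (simp add: ppdna_params_def)
  have cpos: "0 < c k" for k using \<sigma>\<gamma> by (simp add: c_def)
  obtain c0 s0 where c0: "0 < c0" "\<And>k. c0 \<le> c k" and s0: "0 < s0" "\<And>k. s0 \<le> \<sigma> k"
    using assms(6) unfolding param_assumption_def c_def by blast
  have "decseq c"
    unfolding decseq_Suc_iff c_def
    using assms(6) precond_loewner_le_imp unfolding param_assumption_def by blast
  have \<Omega>: "?\<Omega> \<noteq> {}" "compact ?\<Omega>" using ne cpt by (simp_all add: Omega_def)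
  have mnorm_c: "mnorm (precond (\<sigma> k) (\<gamma> k)) (stack x - stack y) = norm (scl (c k) x - scl (c k) y)"
    for k and x y :: "(real^'n) \<times> real"
    using mnorm_precond[OF less_imp_le[OF cpos[of k, unfolded c_def]]] unfolding c_def .
  have D_eq: "dist_M (precond (\<sigma> k) (\<gamma> k)) (stack z) (stack ` ?\<Omega>) = D k z" for k z
    using dist_M_precond[OF _ \<Omega>(1)] cpos[of k] by (simp add: D_def c_def)

  have ppa: "inexact_ppa ?F c \<sigma> \<epsilon> c0 s0 (\<lambda>k. (w k, v k)) (\<lambda>k. prox_point A b lam (\<sigma> k) (\<gamma> k) (w k, v k))"
    if "criterion_A A b lam \<sigma> \<gamma> \<epsilon> w v" for w v
  proof
    show "norm (scl (c k) (w (Suc k), v (Suc k)) - scl (c k) (prox_point A b lam (\<sigma> k) (\<gamma> k) (w k, v k))) \<le> \<epsilon> k" for k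
      using that by (simp add: criterion_A_def mnorm_c)
    show "prox_point A b lam (\<sigma> k) (\<gamma> k) (w k, v k)
      \<in> minimizers (\<lambda>y. ?F y + 1 / (2 * \<sigma> k) * (norm (scl (c k) y - scl (c k) (w k, v k)))\<^sup>2)" for k
      unfolding c_def by (rule prox_point_in_minimizers[OF b lam \<sigma>\<gamma>])
  qed (use convex_objective[OF b lam, of A] continuous_objective[of UNIV A b lam] \<Omega>(1) compact_imp_bounded[OF \<Omega>(2)]
      c0 s0 \<open>decseq c\<close> assms(7,8) in simp_all)

  have r0: "0 \<le> r" unfolding r_def D_def using assms(7,8) by (intro add_nonneg_nonneg infdist_nonneg suminf_nonneg) auto
  \<comment> \<open>The proximal points lie within \<open>r\<close> of the solution set only in the scaled norm, so the error
    bound is taken on a larger Euclidean neighbourhood.\<close>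
  obtain \<kappa> where \<kappa>: "0 < \<kappa>"
    and err: "\<And>z. infdist z ?\<Omega> \<le> r / sqrt (min 1 c0) \<Longrightarrow> infdist z ?\<Omega> \<le> \<kappa> * infdist 0 (T_f A b lam z)"
    using error_bound[OF b lam ne cpt] unfolding Omega_def by metis
  \<comment> \<open>The square root is at most 1, so the enlarged neighbourhood contains the one in
    the claim and a single \<open>\<kappa>\<close> serves both.\<close>
  have r_le: "r \<le> r / sqrt (min 1 c0)"
    using r0 c0(1) by (simp add: le_divide_eq mult_left_le)

  have part1: "bounded (range (\<lambda>k. (w k, v k))) \<and>
        (\<forall>k. D (Suc k) (w (Suc k), v (Suc k)) \<le> D k (w k, v k) + \<epsilon> k) \<and>
        (\<exists>ws vs. (\<lambda>k. (w k, v k)) \<longlonglongrightarrow> (ws, vs) \<and> (ws, vs) \<in> ?\<Omega> \<and> 0 \<in> T_f A b lam (ws, vs))"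
    if "criterion_A A b lam \<sigma> \<gamma> \<epsilon> w v" for w v
  proof -
    interpret inexact_ppa ?F c \<sigma> \<epsilon> c0 s0 "\<lambda>k. (w k, v k)" "\<lambda>k. prox_point A b lam (\<sigma> k) (\<gamma> k) (w k, v k)"
      by (rule ppa[OF that])
    obtain q' where q': "q' \<in> ?\<Omega>" "(\<lambda>k. (w k, v k)) \<longlonglongrightarrow> q'" using converges by (elim bexE)
    obtain ws vs where "q' = (ws, vs)" by (cases q')
    with q' have q: "(ws, vs) \<in> ?\<Omega>" "(\<lambda>k. (w k, v k)) \<longlonglongrightarrow> (ws, vs)" by simp_all
    have T0: "0 \<in> T_f A b lam (ws, vs)"
      using q(1) unfolding T_f_def subdifferential_def minimizers_iff by simp
    show ?thesis
      unfolding D_def by (intro conjI allI exI[of _ ws] exI[of _ vs] bounded_iterates infdist_step q T0)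
  qed

  \<comment> \<open>The names \<open>\<mu>\<close> and \<open>\<mu>inf\<close> are tied down by
    equations, so that instantiating these with \<open>refl\<close> yields the unfolded expressions
    of the goal.\<close>
  have part2: "(\<forall>k. D (Suc k) (w (Suc k), v (Suc k)) \<le> \<mu> k * D k (w k, v k)) \<and>
      limsup (\<lambda>k. ereal (\<mu> k)) = ereal \<mu>inf \<and> \<mu>inf < 1 \<and>
      (\<forall>k. infdist (w (Suc k), v (Suc k)) ?\<Omega> \<le> \<mu> k / sqrt (min 1 (c (Suc k))) * D k (w k, v k))"
    if init: "w 0 = w0" "v 0 = v0" and critA: "criterion_A A b lam \<sigma> \<gamma> \<epsilon> w v"
      and critB: "criterion_B A b lam \<sigma> \<gamma> \<delta> w v" and inc: "incseq \<sigma>"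
      and \<mu>: "\<mu> = (\<lambda>k. 1 / (1 - \<delta> k) * (\<delta> k + (1 + \<delta> k) * \<kappa> * max 1 (c k)
          / sqrt ((\<sigma> k)\<^sup>2 + \<kappa>\<^sup>2 * (max 1 (c k))\<^sup>2)))"
      and \<mu>inf: "\<mu>inf = rate_inf (real_of_ereal (limsup (\<lambda>k. ereal (max 1 (c k))))) \<sigma>inf \<kappa>"
    for \<delta> w v \<mu> \<mu>inf
  proof -
    interpret inexact_ppa ?F c \<sigma> \<epsilon> c0 s0 "\<lambda>k. (w k, v k)" "\<lambda>k. prox_point A b lam (\<sigma> k) (\<gamma> k) (w k, v k)"
      by (rule ppa[OF critA])
    have \<delta>: "0 \<le> \<delta> k" "\<delta> k < 1" "summable \<delta>" for k
      using critB by (auto simp: criterion_B_def)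
    have step: "D (Suc k) (w (Suc k), v (Suc k)) \<le> \<mu> k * D k (w k, v k)" for k
      unfolding \<mu> D_def
    proof (rule linear_step[OF \<delta>(1,2) \<kappa>])
      let ?x = "prox_point A b lam (\<sigma> k) (\<gamma> k) (w k, v k)"
      show "norm (scl (c k) (w (Suc k), v (Suc k)) - scl (c k) ?x)
          \<le> \<delta> k * norm (scl (c k) (w (Suc k), v (Suc k)) - scl (c k) (w k, v k))"
        using critB by (simp add: criterion_B_def mnorm_c)
      \<comment> \<open>The error bound is applied at the exact proximal point, which is no farther
        from the solutions in the scaled norm than the iterate.\<close>
      have "infdist ?x ?\<Omega> \<le> r / sqrt (min 1 c0)"
        using infdist_le_radius[OF order_trans[OF prox_infdist_le infdist_bound], of k] init
        by (simp add: r_def D_def add.commute)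
      then show "infdist ?x ?\<Omega> \<le> \<kappa> * infdist 0 (subdifferential ?F ?x)"
        using err by (simp add: T_f_def)
    qed
    \<comment> \<open>The decreasing weights converge, so the limit superior of the largest
      eigenvalues is a limit.\<close>
    obtain cinf where cinf: "c \<longlonglongrightarrow> cinf"
      using decseq_convergent[OF \<open>decseq c\<close>, of c0] c0(2) by blast
    have l: "(\<lambda>k. max 1 (c k)) \<longlonglongrightarrow> max 1 cinf" by (intro tendsto_max tendsto_const cinf)
    then have "limsup (\<lambda>k. ereal (max 1 (c k))) = ereal (max 1 cinf)"
      by (intro lim_imp_Limsup trivial_limit_sequentially) (simp only: lim_ereal)
    then have \<mu>inf': "\<mu>inf = rate_inf (max 1 cinf) \<sigma>inf \<kappa>"
      by (simp only: \<mu>inf real_of_ereal.simps)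
    have "\<delta> \<longlonglongrightarrow> 0" using \<delta>(3) by (rule summable_LIMSEQ_zero)
    have lims: "\<mu> \<longlonglongrightarrow> \<mu>inf" "\<mu>inf < 1"
      unfolding \<mu> \<mu>inf'
      by (rule rate_tendsto[OF l _ _ \<open>\<delta> \<longlonglongrightarrow> 0\<close> \<kappa> \<sigma>\<gamma>(1) inc \<sigma>inf]; simp)+
    have "limsup (\<lambda>k. ereal (\<mu> k)) = ereal \<mu>inf"
      using lims(1) by (intro lim_imp_Limsup trivial_limit_sequentially) (simp only: lim_ereal)
    moreover have "infdist (w (Suc k), v (Suc k)) ?\<Omega> \<le> \<mu> k / sqrt (min 1 (c (Suc k))) * D k (w k, v k)" for k
    proof -
      have "infdist (w (Suc k), v (Suc k)) ?\<Omega> \<le> D (Suc k) (w (Suc k), v (Suc k)) / sqrt (min 1 (c (Suc k)))"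
        unfolding D_def by (rule infdist_le_scl[OF cpos])
      also have "\<dots> \<le> \<mu> k * D k (w k, v k) / sqrt (min 1 (c (Suc k)))"
        using cpos[of "Suc k"] by (intro divide_right_mono step) auto
      finally show ?thesis by simp
    qed
    ultimately show ?thesis using step lims(2) by blast
  qed

  show ?thesis
    unfolding Let_def Omega_def D_eq lambda_max_precond lambda_min_precond rate_def
      c_def[symmetric] r_def[symmetric]
  proof (intro conjI allI impI exI[of _ \<kappa>], goal_cases)
    case (1 u w v)
    then show ?case using part1 by blast
  next
    case (2 u w v)
    then show ?case using part1 by blast
  next
    case (3 u w v)
    then show ?case using part1 by blast
  next
    case 4
    then show ?case by (rule \<kappa>)
  next
    case (5 w v)
    then show ?case using err r_le by (meson order_trans)
  next
    case (6 \<delta> u w v k)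
    then show ?case using part2[of w v \<delta>, OF _ _ _ _ _ refl refl] by (simp add: ppdna_def)
  next
    case (7 \<delta> u w v)
    then show ?case using part2[of w v \<delta>, OF _ _ _ _ _ refl refl] by (simp add: ppdna_def)
  next
    case (8 \<delta> u w v)
    then show ?case using part2[of w v \<delta>, OF _ _ _ _ _ refl refl] by (simp add: ppdna_def)
  next
    case (9 \<delta> u w v k)
    then show ?case using part2[of w v \<delta>, OF _ _ _ _ _ refl refl] by (simp add: ppdna_def)
  qed
qed

end
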